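(* (Correctness of first-order intuitionistic logic.) For every set of formulas $\Gamma$ and formula $\alpha$ of a first-order language, if $\Gamma\vdash_{\texttt{IL}}\alpha$ then $\Gamma\models\alpha$.
   Context: $\texttt{IL}$ is Gentzen's natural deduction system for first-order intuitionistic logic (with $\bot$, $\wedge,\vee,\rightarrow,\forall,\exists$, $\neg\alpha:=\alpha\rightarrow\bot$). Atomic base $\mathfrak{B}$ on a first-order language $L$: the constants of $L$ plus an atomic system $\texttt{S}$ (recursively axiomatisable rules from atomic premises other than $\bot$ to atomic or $\bot$ conclusions), with a domain of individuals. Grounds on $\mathfrak{B}$ for closed $\alpha$: closed derivations in $\texttt{S}$ for atomic $\alpha$; $\wedge I(g_1,g_2)$, $\vee I(g)$, $\rightarrow I\xi^\alpha(f)$ ($f$ a ground for $\alpha\vdash\beta$), $\exists I(g)$, $\forall Ix(f)$ ($f$ a ground for $\vdash\alpha(x)$); none for $\bot$; nothing else. A $\mathfrak{B}$-operation on grounds of operational type $\tau_1,\dots,\tau_n\rhd\beta$ (entries formulas or first-level types $\Gamma\rhd\gamma$) is a total constructive function given by defining equations mapping individuals and grounds (or first-level operations) for the instantiated entries to grounds for the instantiated co-domain, possibly binding individual variables and typed variables (discharging assumptions) on entries; it is a proper ground if it uses no individual arguments beyond those required by its type. Identity across bases $\approx_{\mathfrak{B}_1,\mathfrak{B}_2}$: built from operations with the same defining equations (same computation instructions) on identical arguments, or the same atomic derivation. A ground $g_1$ on $\mathfrak{B}_1$ over $L_1$ is universal iff for every expansion $L_2$ of $L_1$ and every base $\mathfrak{B}_2$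 on $L_2$ there is a ground $g_2$ on $\mathfrak{B}_2$ with $g_1\approx_{\mathfrak{B}_1,\mathfrak{B}_2}g_2$. An inference $\alpha_1,\dots,\alpha_n/\beta$ on $L$ (possibly binding individual variables and discharging assumptions) is valid over $\mathfrak{B}$ iff there is a $\mathfrak{B}$-operation on grounds $f$ of type $\tau_1,\dots,\tau_n\rhd\beta$, proper ground, where $\tau_i$ is $\alpha_i$ if nothing is discharged on $\alpha_i$ and $\Gamma\rhd\alpha_i$ if $\Gamma$ is discharged on $\alpha_i$, and $f$ binds $x$ and $\xi^\gamma$ on index $i$ iff the inference binds $x$ and discharges $\gamma$ on $\alpha_i$; it is logically valid iff such an $f$ is a universal ground. $\Gamma\models\alpha$ (logical consequence) iff there is a proof of $\alpha$ from $\Gamma$, i.e. a chain of inferences, involving only logically valid inferences; equivalently, iff some composition of universal operations on grounds results in a universal operation on grounds of type $\Gamma\rhd\alpha$. *)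

theory Defs
  imports Main "HOL-Library.Nat_Bijection"
begin

datatype tm = Var nat | Fn nat "tm list"

datatype fm =
    Bot
  | Atom nat "tm list"
  | And fm fm
  | Or fm fm
  | Imp fm fm
  | All nat fm
  | Ex nat fm

abbreviation Neg :: "fm \<Rightarrow> fm" where
  "Neg \<alpha> \<equiv> Imp \<alpha> Bot"

text \<open>
  A language is given by its function symbols (the individual constants are those of arity 0)
  and its predicate symbols, each paired with its arity. All symbols are natural numbers, so a
  language has genuinely new symbols available in its expansions as long as it does not itself
  exhaust them; every countable language is a renaming of one that does not.
\<close>

record lang =
  fun_syms :: "(nat \<times> nat) set"
  pred_syms :: "(nat \<times> nat) set"

definition expansion :: "lang \<Rightarrow> lang \<Rightarrow> bool" where
  "expansion L L' \<longleftrightarrow> fun_syms L \<subseteq> fun_syms L' \<and> pred_syms L \<subseteq> pred_syms L'"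

fun wf_tm :: "lang \<Rightarrow> tm \<Rightarrow> bool" where
  "wf_tm L (Var x) \<longleftrightarrow> True"
| "wf_tm L (Fn f ts) \<longleftrightarrow> (f, length ts) \<in> fun_syms L \<and> (\<forall>t \<in> set ts. wf_tm L t)"

fun wf_fm :: "lang \<Rightarrow> fm \<Rightarrow> bool" where
  "wf_fm L Bot \<longleftrightarrow> True"
| "wf_fm L (Atom p ts) \<longleftrightarrow> (p, length ts) \<in> pred_syms L \<and> (\<forall>t \<in> set ts. wf_tm L t)"
| "wf_fm L (And \<alpha> \<beta>) \<longleftrightarrow> wf_fm L \<alpha> \<and> wf_fm L \<beta>"
| "wf_fm L (Or \<alpha> \<beta>) \<longleftrightarrow> wf_fm L \<alpha> \<and> wf_fm L \<beta>"
| "wf_fm L (Imp \<alpha> \<beta>) \<longleftrightarrow> wf_fm L \<alpha> \<and> wf_fm L \<beta>"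
| "wf_fm L (All x \<alpha>) \<longleftrightarrow> wf_fm L \<alpha>"
| "wf_fm L (Ex x \<alpha>) \<longleftrightarrow> wf_fm L \<alpha>"

definition formulas :: "lang \<Rightarrow> fm set" where
  "formulas L = {\<alpha>. wf_fm L \<alpha>}"

fun fv_tm :: "tm \<Rightarrow> nat set" where
  "fv_tm (Var x) = {x}"
| "fv_tm (Fn f ts) = (\<Union>t \<in> set ts. fv_tm t)"

fun fv :: "fm \<Rightarrow> nat set" where
  "fv Bot = {}"
| "fv (Atom p ts) = (\<Union>t \<in> set ts. fv_tm t)"
| "fv (And \<alpha> \<beta>) = fv \<alpha> \<union> fv \<beta>"
| "fv (Or \<alpha> \<beta>) = fv \<alpha> \<union> fv \<beta>"
| "fv (Imp \<alpha> \<beta>) = fv \<alpha> \<union> fv \<beta>"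
| "fv (All x \<alpha>) = fv \<alpha> - {x}"
| "fv (Ex x \<alpha>) = fv \<alpha> - {x}"

fun tm_subst :: "(nat \<Rightarrow> tm) \<Rightarrow> tm \<Rightarrow> tm" where
  "tm_subst \<sigma> (Var x) = \<sigma> x"
| "tm_subst \<sigma> (Fn f ts) = Fn f (map (tm_subst \<sigma>) ts)"

text \<open>
  Substitution does not rename bound variables. It is only ever used with closed terms or under
  the proviso \<open>free_for\<close>, so that nothing is captured.
\<close>

fun fm_subst :: "(nat \<Rightarrow> tm) \<Rightarrow> fm \<Rightarrow> fm" where
  "fm_subst \<sigma> Bot = Bot"
| "fm_subst \<sigma> (Atom p ts) = Atom p (map (tm_subst \<sigma>) ts)"
| "fm_subst \<sigma> (And \<alpha> \<beta>) = And (fm_subst \<sigma> \<alpha>) (fm_subst \<sigma> \<beta>)"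
| "fm_subst \<sigma> (Or \<alpha> \<beta>) = Or (fm_subst \<sigma> \<alpha>) (fm_subst \<sigma> \<beta>)"
| "fm_subst \<sigma> (Imp \<alpha> \<beta>) = Imp (fm_subst \<sigma> \<alpha>) (fm_subst \<sigma> \<beta>)"
| "fm_subst \<sigma> (All x \<alpha>) = All x (fm_subst (\<sigma>(x := Var x)) \<alpha>)"
| "fm_subst \<sigma> (Ex x \<alpha>) = Ex x (fm_subst (\<sigma>(x := Var x)) \<alpha>)"

abbreviation subst1 :: "fm \<Rightarrow> nat \<Rightarrow> tm \<Rightarrow> fm" where
  "subst1 \<alpha> x t \<equiv> fm_subst (Var(x := t)) \<alpha>"

fun free_for :: "tm \<Rightarrow> nat \<Rightarrow> fm \<Rightarrow> bool" where
  "free_for t x Bot \<longleftrightarrow> True"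
| "free_for t x (Atom p ts) \<longleftrightarrow> True"
| "free_for t x (And \<alpha> \<beta>) \<longleftrightarrow> free_for t x \<alpha> \<and> free_for t x \<beta>"
| "free_for t x (Or \<alpha> \<beta>) \<longleftrightarrow> free_for t x \<alpha> \<and> free_for t x \<beta>"
| "free_for t x (Imp \<alpha> \<beta>) \<longleftrightarrow> free_for t x \<alpha> \<and> free_for t x \<beta>"
| "free_for t x (All y \<alpha>) \<longleftrightarrow> x \<notin> fv (All y \<alpha>) \<or> y \<notin> fv_tm t \<and> free_for t x \<alpha>"
| "free_for t x (Ex y \<alpha>) \<longleftrightarrow> x \<notin> fv (Ex y \<alpha>) \<or> y \<notin> fv_tm t \<and> free_for t x \<alpha>"

datatype recf =
    Zero
  | Succ
  | Proj nat
  | Comp recf "recf list"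
  | PrimRec recf recf
  | Mu recf

inductive recf_eval :: "recf \<Rightarrow> nat list \<Rightarrow> nat \<Rightarrow> bool" where
  "recf_eval Zero xs 0"
| "recf_eval Succ [x] (Suc x)"
| "i < length xs \<Longrightarrow> recf_eval (Proj i) xs (xs ! i)"
| "\<lbrakk>list_all2 (\<lambda>g y. recf_eval g xs y) gs ys; recf_eval f ys z\<rbrakk>
    \<Longrightarrow> recf_eval (Comp f gs) xs z"
| "recf_eval f xs y \<Longrightarrow> recf_eval (PrimRec f g) (0 # xs) y"
| "\<lbrakk>recf_eval (PrimRec f g) (n # xs) y; recf_eval g (n # y # xs) z\<rbrakk>
    \<Longrightarrow> recf_eval (PrimRec f g) (Suc n # xs) z"
| "\<lbrakk>recf_eval f (n # xs) 0; \<forall>m<n. \<exists>y. recf_eval f (m # xs) (Suc y)\<rbrakk>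
    \<Longrightarrow> recf_eval (Mu f) xs n"

definition recursive_set :: "nat set \<Rightarrow> bool" where
  "recursive_set A \<longleftrightarrow> (\<exists>f. \<forall>n. recf_eval f [n] (if n \<in> A then 1 else 0))"

text \<open>
  An atomic rule has atoms as premises and an atom or \<open>\<bottom>\<close> (rendered by \<^const>\<open>None\<close>) as conclusion.
  Its individual variables are schematic: they stand for arbitrary individuals.
\<close>

type_synonym atom = "nat \<times> tm list"
type_synonym atomic_rule = "atom list \<times> atom option"

fun atom_fm :: "atom \<Rightarrow> fm" where
  "atom_fm (p, ts) = Atom p ts"

fun concl_fm :: "atom option \<Rightarrow> fm" where
  "concl_fm None = Bot"
| "concl_fm (Some A) = atom_fm A"

fun tm_encode :: "tm \<Rightarrow> nat" where
  "tm_encode (Var x) = prod_encode (0, x)"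
| "tm_encode (Fn f ts) = prod_encode (1, prod_encode (f, list_encode (map tm_encode ts)))"

fun atom_encode :: "atom \<Rightarrow> nat" where
  "atom_encode (p, ts) = prod_encode (p, list_encode (map tm_encode ts))"

fun rule_encode :: "atomic_rule \<Rightarrow> nat" where
  "rule_encode (As, C) =
     prod_encode (list_encode (map atom_encode As),
                  case C of None \<Rightarrow> 0 | Some A \<Rightarrow> Suc (atom_encode A))"

fun wf_rule :: "lang \<Rightarrow> atomic_rule \<Rightarrow> bool" where
  "wf_rule L (As, C) \<longleftrightarrow> (\<forall>A \<in> set As. wf_fm L (atom_fm A)) \<and> wf_fm L (concl_fm C)"

record base =
  language :: lang
  rules :: "atomic_rule set"

definition atomic_base :: "base \<Rightarrow> bool" where
  "atomic_base B \<longleftrightarrow>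
     (\<forall>r \<in> rules B. wf_rule (language B) r) \<and> recursive_set (rule_encode ` rules B)"

text \<open>
  Grounds are assigned to closed formulas of the language, hence every individual of the domain has
  a name there: the domain consists of the closed terms.
\<close>

definition individuals :: "base \<Rightarrow> tm set" where
  "individuals B = {t. wf_tm (language B) t \<and> fv_tm t = {}}"

text \<open>
  Operations on grounds are total constructive functions given by defining equations. The
  following untyped language of codes makes this precise. An operation symbol is \<open>Op E F\<close>, the
  symbol numbered \<open>F\<close> of the finite system \<open>E\<close> of defining equations; on the right-hand
  sides of \<open>E\<close>, \<open>Call G\<close> refers to the symbol numbered \<open>G\<close> of \<open>E\<close> itself, so that systems may be
  mutually recursive. An operation symbol is applied to individuals and to entries.

  An entry \<open>Abs xs zs e\<close> is a first-level operation, in which the individual variables \<open>xs\<close> and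
  the ground variables \<open>zs\<close> are bound; \<open>Abs [] [] e\<close> is an entry on which nothing is bound.
  \<open>GVar\<close> and \<open>OVar\<close> are variables for grounds and for entries. \<open>App a ts es\<close> is the value of the
  first-level operation \<open>a\<close>.

  \<open>Der C ds\<close> is the atomic derivation of \<open>C\<close> whose last rule has the immediate subderivations \<open>ds\<close>.
  \<open>ExI\<close> records the witnessing individual, as it is needed to compute with the ground; there is
  nothing to record for a vacuous quantifier, since the formula then mentions no individual.
\<close>

datatype gterm =
    GVar nat
  | Der fm "gterm list"
  | AndI gterm gterm
  | OrI1 gterm
  | OrI2 gterm
  | ImpI entry
  | ExI "tm option" gterm
  | AllI entry
  | App entry "tm list" "gterm list"
  | Op "equation list" nat "tm list" "entry list"
  | Call nat "tm list" "entry list"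
and entry =
    OVar nat
  | Abs "nat list" "nat list" gterm
and equation =
    Equation nat "tm list" "entry list" gterm

definition upd :: "('a \<Rightarrow> 'b) \<Rightarrow> 'a list \<Rightarrow> 'b list \<Rightarrow> 'a \<Rightarrow> 'b" where
  "upd f xs ys = (\<lambda>x. case map_of (zip xs ys) x of None \<Rightarrow> f x | Some y \<Rightarrow> y)"

text \<open>
  Simultaneous substitution for individual variables, ground variables, entry variables and
  \<open>Call\<close>s. Variables of defining equations are local to them, so substitution does not act
  on the system \<open>E\<close> of \<open>Op E F\<close>.
\<close>

fun gsubst :: "(nat \<Rightarrow> tm) \<Rightarrow> (nat \<Rightarrow> gterm) \<Rightarrow> (nat \<Rightarrow> entry)
      \<Rightarrow> (nat \<Rightarrow> tm list \<Rightarrow> entry list \<Rightarrow> gterm) \<Rightarrow> gterm \<Rightarrow> gterm"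
  and esubst :: "(nat \<Rightarrow> tm) \<Rightarrow> (nat \<Rightarrow> gterm) \<Rightarrow> (nat \<Rightarrow> entry)
      \<Rightarrow> (nat \<Rightarrow> tm list \<Rightarrow> entry list \<Rightarrow> gterm) \<Rightarrow> entry \<Rightarrow> entry" where
  "gsubst \<sigma> \<theta> \<phi> \<kappa> (GVar z) = \<theta> z"
| "gsubst \<sigma> \<theta> \<phi> \<kappa> (Der C ds) = Der (fm_subst \<sigma> C) (map (gsubst \<sigma> \<theta> \<phi> \<kappa>) ds)"
| "gsubst \<sigma> \<theta> \<phi> \<kappa> (AndI d e) = AndI (gsubst \<sigma> \<theta> \<phi> \<kappa> d) (gsubst \<sigma> \<theta> \<phi> \<kappa> e)"
| "gsubst \<sigma> \<theta> \<phi> \<kappa> (OrI1 e) = OrI1 (gsubst \<sigma> \<theta> \<phi> \<kappa> e)"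
| "gsubst \<sigma> \<theta> \<phi> \<kappa> (OrI2 e) = OrI2 (gsubst \<sigma> \<theta> \<phi> \<kappa> e)"
| "gsubst \<sigma> \<theta> \<phi> \<kappa> (ImpI a) = ImpI (esubst \<sigma> \<theta> \<phi> \<kappa> a)"
| "gsubst \<sigma> \<theta> \<phi> \<kappa> (ExI w e) = ExI (map_option (tm_subst \<sigma>) w) (gsubst \<sigma> \<theta> \<phi> \<kappa> e)"
| "gsubst \<sigma> \<theta> \<phi> \<kappa> (AllI a) = AllI (esubst \<sigma> \<theta> \<phi> \<kappa> a)"
| "gsubst \<sigma> \<theta> \<phi> \<kappa> (App a ts es) =
     App (esubst \<sigma> \<theta> \<phi> \<kappa> a) (map (tm_subst \<sigma>) ts) (map (gsubst \<sigma> \<theta> \<phi> \<kappa>) es)"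
| "gsubst \<sigma> \<theta> \<phi> \<kappa> (Op E F ts as) = Op E F (map (tm_subst \<sigma>) ts) (map (esubst \<sigma> \<theta> \<phi> \<kappa>) as)"
| "gsubst \<sigma> \<theta> \<phi> \<kappa> (Call F ts as) = \<kappa> F (map (tm_subst \<sigma>) ts) (map (esubst \<sigma> \<theta> \<phi> \<kappa>) as)"
| "esubst \<sigma> \<theta> \<phi> \<kappa> (OVar f) = \<phi> f"
| "esubst \<sigma> \<theta> \<phi> \<kappa> (Abs xs zs e) =
     Abs xs zs (gsubst (\<lambda>x. if x \<in> set xs then Var x else \<sigma> x)
                       (\<lambda>z. if z \<in> set zs then GVar z else \<theta> z) \<phi> \<kappa> e)"

text \<open>A code without free variables (or dangling \<open>Call\<close>s) is one left unchanged by every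
  substitution.\<close>

definition closed_gterm :: "gterm \<Rightarrow> bool" where
  "closed_gterm e \<longleftrightarrow> (\<forall>\<sigma> \<theta> \<phi> \<kappa>. gsubst \<sigma> \<theta> \<phi> \<kappa> e = e)"

definition closed_entry :: "entry \<Rightarrow> bool" where
  "closed_entry a \<longleftrightarrow> (\<forall>\<sigma> \<theta> \<phi> \<kappa>. esubst \<sigma> \<theta> \<phi> \<kappa> a = a)"

text \<open>
  Left-hand sides of defining equations are built from variables and the primitive operations only;
  in particular they cannot inspect the code of a first-level operation.
\<close>

fun pattern :: "gterm \<Rightarrow> bool" where
  "pattern (GVar z) \<longleftrightarrow> True"
| "pattern (Der C ds) \<longleftrightarrow> (\<forall>d \<in> set ds. pattern d)"
| "pattern (AndI d e) \<longleftrightarrow> pattern d \<and> pattern e"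
| "pattern (OrI1 e) \<longleftrightarrow> pattern e"
| "pattern (OrI2 e) \<longleftrightarrow> pattern e"
| "pattern (ImpI a) \<longleftrightarrow> (\<exists>f. a = OVar f)"
| "pattern (ExI w e) \<longleftrightarrow> pattern e"
| "pattern (AllI a) \<longleftrightarrow> (\<exists>f. a = OVar f)"
| "pattern (App a ts es) \<longleftrightarrow> False"
| "pattern (Op E F ts as) \<longleftrightarrow> False"
| "pattern (Call F ts as) \<longleftrightarrow> False"

fun entry_pattern :: "entry \<Rightarrow> bool" where
  "entry_pattern (OVar f) \<longleftrightarrow> True"
| "entry_pattern (Abs xs zs e) \<longleftrightarrow> xs = [] \<and> zs = [] \<and> pattern e"

text \<open>
  Computation of the canonical form of a code. An application of an operation symbol is computed
  by first computing the entries on which nothing is bound and then replacing the left-hand side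
  of an instance of a defining equation by its right-hand side.
\<close>

inductive eval :: "gterm \<Rightarrow> gterm \<Rightarrow> bool"
  and eval_entry :: "entry \<Rightarrow> entry \<Rightarrow> bool" where
  "list_all2 eval ds vs \<Longrightarrow> eval (Der C ds) (Der C vs)"
| "\<lbrakk>eval d v; eval e w\<rbrakk> \<Longrightarrow> eval (AndI d e) (AndI v w)"
| "eval e v \<Longrightarrow> eval (OrI1 e) (OrI1 v)"
| "eval e v \<Longrightarrow> eval (OrI2 e) (OrI2 v)"
| "eval (ImpI a) (ImpI a)"
| "eval e v \<Longrightarrow> eval (ExI w e) (ExI w v)"
| "eval (AllI a) (AllI a)"
| "\<lbrakk>length ts = length xs; length es = length zs; list_all2 eval es vs;
    eval (gsubst (upd Var xs ts) (upd GVar zs vs) OVar Call e) v\<rbrakk>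
    \<Longrightarrow> eval (App (Abs xs zs e) ts es) v"
| "\<lbrakk>list_all2 eval_entry as (map (esubst \<sigma> \<theta> \<phi> Call) ps);
    Equation F qs ps r \<in> set E; \<forall>p \<in> set ps. entry_pattern p;
    \<forall>x. fv_tm (\<sigma> x) = {}; \<forall>z. closed_gterm (\<theta> z); \<forall>f. closed_entry (\<phi> f);
    ts = map (tm_subst \<sigma>) qs; eval (gsubst \<sigma> \<theta> \<phi> (Op E) r) v\<rbrakk>
    \<Longrightarrow> eval (Op E F ts as) v"
| "eval e v \<Longrightarrow> eval_entry (Abs [] [] e) (Abs [] [] v)"
| "xs \<noteq> [] \<or> zs \<noteq> [] \<Longrightarrow> eval_entry (Abs xs zs e) (Abs xs zs e)"

text \<open>The computation of \<open>e\<close> has exactly one result, and it satisfies \<open>P\<close>.\<close>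

definition yields :: "gterm \<Rightarrow> (gterm \<Rightarrow> bool) \<Rightarrow> bool" where
  "yields e P \<longleftrightarrow> (\<exists>v. (\<forall>w. eval e w \<longleftrightarrow> w = v) \<and> P v)"

text \<open>\<open>derivation B g A\<close>: \<open>g\<close> is a closed derivation of the closed formula \<open>A\<close> in the atomic system
  of \<open>B\<close>.\<close>

inductive derivation :: "base \<Rightarrow> gterm \<Rightarrow> fm \<Rightarrow> bool" for B where
  "\<lbrakk>(As, C) \<in> rules B;
    \<forall>x \<in> (\<Union>A \<in> set As. fv (atom_fm A)) \<union> fv (concl_fm C). \<sigma> x \<in> individuals B;
    list_all2 (\<lambda>d A. derivation B d (fm_subst \<sigma> (atom_fm A))) ds As\<rbrakk>
    \<Longrightarrow> derivation B (Der (fm_subst \<sigma> (concl_fm C)) ds) (fm_subst \<sigma> (concl_fm C))"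

lemma size_fm_subst [simp]: "size (fm_subst \<sigma> \<alpha>) = size \<alpha>"
  by (induction \<alpha> arbitrary: \<sigma>) auto

text \<open>
  \<open>ground B \<alpha> g\<close>: \<open>g\<close> is a ground on \<open>B\<close> for the closed formula \<open>\<alpha>\<close>. In the clause for \<open>\<forall>\<close>, the
  first-level operation is a ground for \<open>\<turnstile> \<alpha>(x)\<close>, so it has \<open>x\<close> as an argument only if \<open>x\<close> is free
  in \<open>\<alpha>\<close>.
\<close>

function ground :: "base \<Rightarrow> fm \<Rightarrow> gterm \<Rightarrow> bool" where
  "ground B Bot g \<longleftrightarrow> False"
| "ground B (Atom p ts) g \<longleftrightarrow> derivation B g (Atom p ts)"
| "ground B (And \<alpha> \<beta>) g \<longleftrightarrow> (\<exists>h k. g = AndI h k \<and> ground B \<alpha> h \<and> ground B \<beta> k)"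
| "ground B (Or \<alpha> \<beta>) g \<longleftrightarrow>
     (\<exists>h. g = OrI1 h \<and> ground B \<alpha> h) \<or> (\<exists>h. g = OrI2 h \<and> ground B \<beta> h)"
| "ground B (Imp \<alpha> \<beta>) g \<longleftrightarrow>
     (\<exists>z e. g = ImpI (Abs [] [z] e) \<and> closed_entry (Abs [] [z] e) \<and>
       (\<forall>h. ground B \<alpha> h \<longrightarrow> yields (App (Abs [] [z] e) [] [h]) (\<lambda>v. ground B \<beta> v)))"
| "ground B (Ex x \<alpha>) g \<longleftrightarrow>
     (if x \<in> fv \<alpha>
      then \<exists>t h. g = ExI (Some t) h \<and> t \<in> individuals B \<and> ground B (subst1 \<alpha> x t) h
      else \<exists>h. g = ExI None h \<and> ground B \<alpha> h)"
| "ground B (All x \<alpha>) g \<longleftrightarrow>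
     (if x \<in> fv \<alpha>
      then \<exists>y e. g = AllI (Abs [y] [] e) \<and> closed_entry (Abs [y] [] e) \<and>
             (\<forall>t \<in> individuals B.
                yields (App (Abs [y] [] e) [t] []) (\<lambda>v. ground B (subst1 \<alpha> x t) v))
      else \<exists>e. g = AllI (Abs [] [] e) \<and> closed_entry (Abs [] [] e) \<and>
             yields (App (Abs [] [] e) [] []) (\<lambda>v. ground B \<alpha> v))"
  by pat_completeness auto
termination
  by (relation "measure (\<lambda>(B, \<alpha>, g). size \<alpha>)") auto

text \<open>
  \<open>(X, \<Gamma>, \<alpha>)\<close> stands for the entry \<open>\<Gamma> \<rhd> \<alpha>\<close> of an operational type (for \<open>\<alpha>\<close>, if \<open>\<Gamma>\<close> is empty), on which
  the individual variables \<open>X\<close> and typed variables for the formulas in \<open>\<Gamma>\<close> are bound.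
\<close>

type_synonym entry_type = "nat list \<times> fm list \<times> fm"
type_synonym op_type = "entry_type list \<times> fm"

fun fv_entry :: "entry_type \<Rightarrow> nat set" where
  "fv_entry (X, \<Gamma>, \<alpha>) = ((\<Union>\<gamma> \<in> set \<Gamma>. fv \<gamma>) \<union> fv \<alpha>) - set X"

fun fv_type :: "op_type \<Rightarrow> nat set" where
  "fv_type (\<tau>s, \<beta>) = (\<Union>\<tau> \<in> set \<tau>s. fv_entry \<tau>) \<union> fv \<beta>"

text \<open>
  \<open>\<sigma>\<close> instantiates the free individual variables of the type. Being a ground, a first-level
  operation has only those of the variables \<open>X\<close> as arguments that its type requires.
\<close>

fun first_level :: "base \<Rightarrow> (nat \<Rightarrow> tm) \<Rightarrow> entry_type \<Rightarrow> entry \<Rightarrow> bool" where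
  "first_level B \<sigma> (X, \<Gamma>, \<alpha>) a \<longleftrightarrow>
     (let X' = filter (\<lambda>x. x \<in> (\<Union>\<gamma> \<in> set \<Gamma>. fv \<gamma>) \<union> fv \<alpha>) X
      in \<exists>ys zs e. a = Abs ys zs e \<and> length ys = length X' \<and> length zs = length \<Gamma> \<and>
           closed_entry a \<and>
           (\<forall>ts hs. length ts = length X' \<longrightarrow> set ts \<subseteq> individuals B \<longrightarrow>
              list_all2 (\<lambda>\<gamma> h. ground B (fm_subst (upd \<sigma> X' ts) \<gamma>) h) \<Gamma> hs \<longrightarrow>
              yields (App a ts hs) (ground B (fm_subst (upd \<sigma> X' ts) \<alpha>))))"

text \<open>An operation \<open>(E, F, xs)\<close> is an operation symbol together with its individual arguments.\<close>

type_synonym operation = "equation list \<times> nat \<times> nat list"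

fun operation_on :: "base \<Rightarrow> op_type \<Rightarrow> operation \<Rightarrow> bool" where
  "operation_on B (\<tau>s, \<beta>) (E, F, xs) \<longleftrightarrow>
     (\<forall>\<sigma> as. (\<forall>x \<in> fv_type (\<tau>s, \<beta>) \<union> set xs. \<sigma> x \<in> individuals B) \<longrightarrow>
        list_all2 (first_level B \<sigma>) \<tau>s as \<longrightarrow>
        yields (Op E F (map \<sigma> xs) as) (ground B (fm_subst \<sigma> \<beta>)))"

fun proper_ground :: "base \<Rightarrow> op_type \<Rightarrow> operation \<Rightarrow> bool" where
  "proper_ground B \<tau> (E, F, xs) \<longleftrightarrow> operation_on B \<tau> (E, F, xs) \<and> set xs \<subseteq> fv_type \<tau>"

text \<open>
  A code consists of nothing but defining equations, terms and atomic derivations; thus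
  grounds on different bases are built by the same computation instructions iff their codes are
  equal. Codes are untyped, so the common type has to be given.
\<close>

definition ground_identical :: "base \<Rightarrow> base \<Rightarrow> op_type \<Rightarrow> operation \<Rightarrow> operation \<Rightarrow> bool" where
  "ground_identical B B' \<tau> f f' \<longleftrightarrow> proper_ground B \<tau> f \<and> proper_ground B' \<tau> f' \<and> f = f'"

definition universal_ground :: "base \<Rightarrow> op_type \<Rightarrow> operation \<Rightarrow> bool" where
  "universal_ground B \<tau> f \<longleftrightarrow>
     proper_ground B \<tau> f \<and>
     (\<forall>B'. atomic_base B' \<and> expansion (language B) (language B')
        \<longrightarrow> (\<exists>f'. ground_identical B B' \<tau> f f'))"

text \<open>
  In an inference \<open>(ps, \<beta>)\<close> each member \<open>(X, \<Gamma>, \<alpha>)\<close> of \<open>ps\<close> is a premise \<open>\<alpha>\<close> on which the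
  individual variables \<open>X\<close> are bound and the assumptions \<open>\<Gamma>\<close> are discharged. Its operational type is
  therefore given by the same data.
\<close>

type_synonym inference = "entry_type list \<times> fm"

fun inference_on :: "lang \<Rightarrow> inference \<Rightarrow> bool" where
  "inference_on L (ps, \<beta>) \<longleftrightarrow>
     (\<forall>(X, \<Gamma>, \<alpha>) \<in> set ps. distinct X \<and> distinct \<Gamma> \<and> set \<Gamma> \<subseteq> formulas L \<and> \<alpha> \<in> formulas L) \<and>
     \<beta> \<in> formulas L"

definition valid_over :: "base \<Rightarrow> inference \<Rightarrow> bool" where
  "valid_over B i \<longleftrightarrow> inference_on (language B) i \<and> (\<exists>f. proper_ground B i f)"

definition logically_valid :: "lang \<Rightarrow> inference \<Rightarrow> bool" where
  "logically_valid L i \<longleftrightarrow>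
     inference_on L i \<and>
     (\<exists>B f. atomic_base B \<and> language B = L \<and> universal_ground B i f)"

text \<open>
  \<open>chain L R \<Delta> \<alpha>\<close>: there is a chain of inferences from \<open>R\<close> with conclusion \<open>\<alpha>\<close> and set \<open>\<Delta>\<close> of
  undischarged assumptions. An individual variable bound on a premise must not be free in the
  assumptions on which that premise depends and which the inference leaves undischarged.
\<close>

inductive chain :: "lang \<Rightarrow> (inference \<Rightarrow> bool) \<Rightarrow> fm set \<Rightarrow> fm \<Rightarrow> bool" for L R where
  assumption: "\<alpha> \<in> formulas L \<Longrightarrow> chain L R {\<alpha>} \<alpha>"
| inference: "\<lbrakk>R (ps, \<beta>); length \<Delta>s = length ps;
    \<forall>i<length ps. case ps ! i of (X, \<Gamma>, \<alpha>) \<Rightarrow>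
      chain L R (\<Delta>s ! i) \<alpha> \<and> (\<forall>\<delta> \<in> \<Delta>s ! i - set \<Gamma>. fv \<delta> \<inter> set X = {})\<rbrakk>
    \<Longrightarrow> chain L R (\<Union>i<length ps. case ps ! i of (X, \<Gamma>, \<alpha>) \<Rightarrow> \<Delta>s ! i - set \<Gamma>) \<beta>"

definition logical_consequence :: "lang \<Rightarrow> fm set \<Rightarrow> fm \<Rightarrow> bool" where
  "logical_consequence L \<Gamma> \<alpha> \<longleftrightarrow> (\<exists>\<Delta> \<subseteq> \<Gamma>. chain L (logically_valid L) \<Delta> \<alpha>)"

inductive IL_rule :: "inference \<Rightarrow> bool" where
  AndI: "IL_rule ([([], [], \<alpha>), ([], [], \<beta>)], And \<alpha> \<beta>)"
| AndE1: "IL_rule ([([], [], And \<alpha> \<beta>)], \<alpha>)"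
| AndE2: "IL_rule ([([], [], And \<alpha> \<beta>)], \<beta>)"
| OrI1: "IL_rule ([([], [], \<alpha>)], Or \<alpha> \<beta>)"
| OrI2: "IL_rule ([([], [], \<beta>)], Or \<alpha> \<beta>)"
| OrE: "IL_rule ([([], [], Or \<alpha> \<beta>), ([], [\<alpha>], \<gamma>), ([], [\<beta>], \<gamma>)], \<gamma>)"
| ImpI: "IL_rule ([([], [\<alpha>], \<beta>)], Imp \<alpha> \<beta>)"
| ImpE: "IL_rule ([([], [], Imp \<alpha> \<beta>), ([], [], \<alpha>)], \<beta>)"
| AllI: "\<lbrakk>free_for (Var y) x \<alpha>; y \<notin> fv (All x \<alpha>)\<rbrakk>
    \<Longrightarrow> IL_rule ([([y], [], subst1 \<alpha> x (Var y))], All x \<alpha>)"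
| AllE: "free_for t x \<alpha> \<Longrightarrow> IL_rule ([([], [], All x \<alpha>)], subst1 \<alpha> x t)"
| ExI: "free_for t x \<alpha> \<Longrightarrow> IL_rule ([([], [], subst1 \<alpha> x t)], Ex x \<alpha>)"
| ExE: "\<lbrakk>free_for (Var y) x \<alpha>; y \<notin> fv (Ex x \<alpha>); y \<notin> fv \<gamma>\<rbrakk>
    \<Longrightarrow> IL_rule ([([], [], Ex x \<alpha>), ([y], [subst1 \<alpha> x (Var y)], \<gamma>)], \<gamma>)"
| BotE: "IL_rule ([([], [], Bot)], \<alpha>)"

definition IL_derivable :: "lang \<Rightarrow> fm set \<Rightarrow> fm \<Rightarrow> bool" where
  "IL_derivable L \<Gamma> \<alpha> \<longleftrightarrow>
     (\<exists>\<Delta> \<subseteq> \<Gamma>. chain L (\<lambda>i. inference_on L i \<and> IL_rule i) \<Delta> \<alpha>)"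

end

theory Submission
  imports Defs
begin

text \<open>
  It suffices that every instance of a rule of \<open>IL\<close> is logically valid, since a chain of inferences
  of \<open>IL\<close> is then a chain of logically valid ones. The operation that validates a rule is given by
  Prawitz's reduction: introductions return the corresponding primitive operation, eliminations
  match a canonical ground and apply the first-level operation found in it. These equations mention
  neither the language nor the atomic rules, so the base without rules on \<open>L\<close> witnesses logical
  validity. For the quantifier rules the equations depend on whether \<open>x\<close> is free in \<open>\<alpha>\<close>, because the
  grounds do. The individual arguments allowed by the type are those needed to evaluate the
  term \<open>t\<close> of \<open>\<forall>E\<close> and \<open>\<exists>I\<close>: if \<open>x\<close> is free in \<open>\<alpha>\<close>, then all variables of \<open>t\<close> are free in \<open>\<alpha>(t)\<close>.
\<close>

lemma upd_Nil [simp]: "upd f [] ys = f"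
  by (simp add: upd_def)

lemma upd_single [simp]: "upd f [x] [y] = f(x := y)"
  by (auto simp: upd_def fun_eq_iff)


subsection \<open>Substitution\<close>

lemma tm_subst_cong: "(\<And>x. x \<in> fv_tm t \<Longrightarrow> \<sigma> x = \<tau> x) \<Longrightarrow> tm_subst \<sigma> t = tm_subst \<tau> t"
  by (induction t) auto

lemma tm_subst_Var [simp]: "tm_subst Var t = t"
  by (induction t) (auto simp: map_idI)

lemma tm_subst_closed [simp]: "fv_tm t = {} \<Longrightarrow> tm_subst \<sigma> t = t"
  using tm_subst_cong[of t \<sigma> Var] by simp

lemma tm_subst_tm_subst: "tm_subst \<tau> (tm_subst \<sigma> t) = tm_subst (\<lambda>x. tm_subst \<tau> (\<sigma> x)) t"
  by (induction t) auto

lemma fv_tm_subst: "fv_tm (tm_subst \<sigma> t) = (\<Union>x \<in> fv_tm t. fv_tm (\<sigma> x))"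
  by (induction t) auto

lemma finite_fv_tm: "finite (fv_tm t)"
  by (induction t) auto

lemma wf_tm_subst: "wf_tm L t \<Longrightarrow> (\<And>x. x \<in> fv_tm t \<Longrightarrow> wf_tm L (\<sigma> x)) \<Longrightarrow> wf_tm L (tm_subst \<sigma> t)"
  by (induction t) auto

lemma wf_tm_subst_var: "wf_tm L (tm_subst \<sigma> t) \<Longrightarrow> x \<in> fv_tm t \<Longrightarrow> wf_tm L (\<sigma> x)"
  by (induction t) auto

lemma fm_subst_cong: "(\<And>x. x \<in> fv \<alpha> \<Longrightarrow> \<sigma> x = \<tau> x) \<Longrightarrow> fm_subst \<sigma> \<alpha> = fm_subst \<tau> \<alpha>"
proof (induction \<alpha> arbitrary: \<sigma> \<tau>)
  case (Atom p ts)
  then show ?case by (force intro: tm_subst_cong)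
next
  case (All x \<alpha>)
  have "fm_subst (\<sigma>(x := Var x)) \<alpha> = fm_subst (\<tau>(x := Var x)) \<alpha>"
    using All.prems by (intro All.IH) simp
  then show ?case by simp
next
  case (Ex x \<alpha>)
  have "fm_subst (\<sigma>(x := Var x)) \<alpha> = fm_subst (\<tau>(x := Var x)) \<alpha>"
    using Ex.prems by (intro Ex.IH) simp
  then show ?case by simp
next
  case (And \<alpha> \<beta>)
  show ?case using And.IH(1)[OF And.prems] And.IH(2)[OF And.prems] by simp
next
  case (Or \<alpha> \<beta>)
  show ?case using Or.IH(1)[OF Or.prems] Or.IH(2)[OF Or.prems] by simp
next
  case (Imp \<alpha> \<beta>)
  show ?case using Imp.IH(1)[OF Imp.prems] Imp.IH(2)[OF Imp.prems] by simp
qed simp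

lemma fm_subst_Var [simp]: "fm_subst Var \<alpha> = \<alpha>"
  by (induction \<alpha>) (auto simp: map_idI fun_upd_idem)

lemma fm_subst_closed: "fv \<alpha> = {} \<Longrightarrow> fm_subst \<sigma> \<alpha> = \<alpha>"
  using fm_subst_cong[of \<alpha> \<sigma> Var] by simp

lemma subst1_vacuous: "x \<notin> fv \<alpha> \<Longrightarrow> subst1 \<alpha> x t = \<alpha>"
  by (subst fm_subst_Var[of \<alpha>, symmetric], rule fm_subst_cong) auto

text \<open>The condition is the one met below quantifiers: individuals are closed terms, and
  \<open>fm_subst\<close> resets a bound variable to itself. Neither kind of value can be captured,
  so substitution without renaming is harmless.\<close>

lemma fv_fm_subst_closing:
  assumes "\<And>z. z \<in> fv \<alpha> \<Longrightarrow> \<sigma> z = Var z \<or> fv_tm (\<sigma> z) = {}"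
  shows "fv (fm_subst \<sigma> \<alpha>) = {z \<in> fv \<alpha>. \<sigma> z = Var z}"
  using assms
proof (induction \<alpha> arbitrary: \<sigma>)
  case (Atom p ts)
  have "x \<in> fv_tm (\<sigma> z) \<longleftrightarrow> x = z \<and> \<sigma> z = Var z" if "t \<in> set ts" "z \<in> fv_tm t" for x z t
  proof -
    have "\<sigma> z = Var z \<or> fv_tm (\<sigma> z) = {}" using Atom that by auto
    then show ?thesis by auto
  qed
  then show ?case by (auto simp: fv_tm_subst)
next
  case (All x \<alpha>)
  have "fv (fm_subst (\<sigma>(x := Var x)) \<alpha>) = {z \<in> fv \<alpha>. (\<sigma>(x := Var x)) z = Var z}"
    using All.prems by (intro All.IH) auto
  then show ?case by auto
next
  case (Ex x \<alpha>)
  have "fv (fm_subst (\<sigma>(x := Var x)) \<alpha>) = {z \<in> fv \<alpha>. (\<sigma>(x := Var x)) z = Var z}"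
    using Ex.prems by (intro Ex.IH) auto
  then show ?case by auto
next
  case (And \<alpha> \<beta>)
  show ?case using And.IH(1)[OF And.prems] And.IH(2)[OF And.prems] by auto
next
  case (Or \<alpha> \<beta>)
  show ?case using Or.IH(1)[OF Or.prems] Or.IH(2)[OF Or.prems] by auto
next
  case (Imp \<alpha> \<beta>)
  show ?case using Imp.IH(1)[OF Imp.prems] Imp.IH(2)[OF Imp.prems] by auto
qed simp

text \<open>Without renaming, substitutions compose as long as no binder captures what the inner one
  inserts; closed terms and variables mapped to themselves are safe.\<close>

lemma fm_subst_fm_subst_closing:
  assumes "\<And>z. z \<in> fv \<alpha> \<Longrightarrow> \<sigma> z = Var z \<or> fv_tm (\<sigma> z) = {}"
  shows "fm_subst \<tau> (fm_subst \<sigma> \<alpha>) = fm_subst (\<lambda>x. tm_subst \<tau> (\<sigma> x)) \<alpha>"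
  using assms
proof (induction \<alpha> arbitrary: \<sigma> \<tau>)
  case (Atom p ts)
  then show ?case by (auto simp: tm_subst_tm_subst)
next
  case (All x \<alpha>)
  have "fm_subst (\<tau>(x := Var x)) (fm_subst (\<sigma>(x := Var x)) \<alpha>)
      = fm_subst (\<lambda>z. tm_subst (\<tau>(x := Var x)) ((\<sigma>(x := Var x)) z)) \<alpha>"
    using All.prems by (intro All.IH) auto
  \<comment> \<open>At \<open>x\<close> both sides are \<open>Var x\<close>. Elsewhere
    \<open>\<sigma> z\<close> is closed or is \<open>Var z\<close> with \<open>z \<noteq> x\<close>,
    so resetting \<open>\<tau>\<close> at \<open>x\<close> has no effect on it.\<close>
  also have "\<dots> = fm_subst ((\<lambda>z. tm_subst \<tau> (\<sigma> z))(x := Var x)) \<alpha>"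
  proof (rule fm_subst_cong)
    fix z assume "z \<in> fv \<alpha>"
    then show "tm_subst (\<tau>(x := Var x)) ((\<sigma>(x := Var x)) z) = ((\<lambda>z. tm_subst \<tau> (\<sigma> z))(x := Var x)) z"
      using All.prems[of z] by (cases "z = x") auto
  qed
  finally show ?case by simp
next
  case (Ex x \<alpha>)
  have "fm_subst (\<tau>(x := Var x)) (fm_subst (\<sigma>(x := Var x)) \<alpha>)
      = fm_subst (\<lambda>z. tm_subst (\<tau>(x := Var x)) ((\<sigma>(x := Var x)) z)) \<alpha>"
    using Ex.prems by (intro Ex.IH) auto
  also have "\<dots> = fm_subst ((\<lambda>z. tm_subst \<tau> (\<sigma> z))(x := Var x)) \<alpha>"
  proof (rule fm_subst_cong)
    fix z assume "z \<in> fv \<alpha>"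
    then show "tm_subst (\<tau>(x := Var x)) ((\<sigma>(x := Var x)) z) = ((\<lambda>z. tm_subst \<tau> (\<sigma> z))(x := Var x)) z"
      using Ex.prems[of z] by (cases "z = x") auto
  qed
  finally show ?case by simp
next
  case (And \<alpha> \<beta>)
  show ?case using And.IH(1)[OF And.prems] And.IH(2)[OF And.prems] by simp
next
  case (Or \<alpha> \<beta>)
  show ?case using Or.IH(1)[OF Or.prems] Or.IH(2)[OF Or.prems] by simp
next
  case (Imp \<alpha> \<beta>)
  show ?case using Imp.IH(1)[OF Imp.prems] Imp.IH(2)[OF Imp.prems] by simp
qed simp

text \<open>The quantifier clauses of \<open>ground\<close> instantiate the body after
  \<open>\<sigma>\<close> has passed below the quantifier, hence with \<open>x\<close> reset. As
  \<open>\<sigma>\<close> puts closed terms elsewhere, the later instance merges into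
  \<open>\<sigma>\<close>.\<close>

lemma subst1_fm_subst:
  assumes "\<And>z. z \<in> fv \<alpha> - {x} \<Longrightarrow> fv_tm (\<sigma> z) = {}"
  shows "subst1 (fm_subst (\<sigma>(x := Var x)) \<alpha>) x t = fm_subst (\<sigma>(x := t)) \<alpha>"
proof -
  have "subst1 (fm_subst (\<sigma>(x := Var x)) \<alpha>) x t
      = fm_subst (\<lambda>z. tm_subst (Var(x := t)) ((\<sigma>(x := Var x)) z)) \<alpha>"
    using assms by (intro fm_subst_fm_subst_closing) auto
  also have "\<dots> = fm_subst (\<sigma>(x := t)) \<alpha>"
    using assms by (intro fm_subst_cong) auto
  finally show ?thesis .
qed

text \<open>For an open term the safeguard against capture is \<open>free_for\<close>. This turns
  the conclusion of \<open>AllE\<close> and the premise of \<open>ExI\<close>, once instantiated,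
  into an instance of \<open>\<alpha>\<close> at the value of \<open>t\<close>.\<close>

lemma fm_subst_subst1:
  assumes "free_for t x \<alpha>"
  shows "fm_subst \<tau> (subst1 \<alpha> x t) = fm_subst (\<tau>(x := tm_subst \<tau> t)) \<alpha>"
  using assms
proof (induction \<alpha> arbitrary: \<tau>)
  case (Atom p ts)
  then show ?case by (auto simp: tm_subst_tm_subst intro!: tm_subst_cong)
next
  case (All y \<alpha>)
  show ?case
  proof (cases "x \<in> fv (All y \<alpha>)")
    case True
    \<comment> \<open>As \<open>x\<close> is free below the binder, the proviso gives
      \<open>y \<notin> fv_tm t\<close>: resetting \<open>y\<close> leaves the value of
      \<open>t\<close> alone, and the updates at \<open>x\<close> and \<open>y\<close>
      commute.\<close>
    with All.prems have y: "y \<notin> fv_tm t" "free_for t x \<alpha>" "x \<noteq> y" by auto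
    then have "tm_subst (\<tau>(y := Var y)) t = tm_subst \<tau> t"
      by (intro tm_subst_cong) auto
    moreover have "Var(x := t, y := Var y) = Var(x := t)" using y by auto
    moreover note All.IH[of "\<tau>(y := Var y)"]
    ultimately show ?thesis
      using y by (simp add: fun_upd_twist del: fun_upd_apply)
  next
    case False
    then show ?thesis
      unfolding subst1_vacuous[OF False] by (intro fm_subst_cong) auto
  qed
next
  case (Ex y \<alpha>)
  show ?case
  proof (cases "x \<in> fv (Ex y \<alpha>)")
    case True
    with Ex.prems have y: "y \<notin> fv_tm t" "free_for t x \<alpha>" "x \<noteq> y" by auto
    then have "tm_subst (\<tau>(y := Var y)) t = tm_subst \<tau> t"
      by (intro tm_subst_cong) auto
    moreover have "Var(x := t, y := Var y) = Var(x := t)" using y by auto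
    moreover note Ex.IH[of "\<tau>(y := Var y)"]
    ultimately show ?thesis
      using y by (simp add: fun_upd_twist del: fun_upd_apply)
  next
    case False
    then show ?thesis
      unfolding subst1_vacuous[OF False] by (intro fm_subst_cong) auto
  qed
qed auto

lemma fv_tm_subst1:
  "fv_tm (tm_subst (Var(x := t)) s) = fv_tm s - {x} \<union> (if x \<in> fv_tm s then fv_tm t else {})"
  by (force simp: fv_tm_subst split: if_splits)

text \<open>If \<open>x\<close> is free in \<open>\<alpha>\<close>, this makes the variables of
  \<open>t\<close> legitimate individual arguments of the operations for \<open>AllE\<close> and
  \<open>ExI\<close>.\<close>

lemma fv_subst1:
  assumes "free_for t x \<alpha>"
  shows "fv (subst1 \<alpha> x t) = fv \<alpha> - {x} \<union> (if x \<in> fv \<alpha> then fv_tm t else {})"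
  using assms
proof (induction \<alpha>)
  case (Atom p ts)
  then show ?case by (auto simp: fv_tm_subst1 simp del: fun_upd_apply split: if_splits)
next
  case (All y \<alpha>)
  show ?case
  proof (cases "x \<in> fv (All y \<alpha>)")
    case True
    then have "Var(x := t, y := Var y) = Var(x := t)" by auto
    with True All show ?thesis by (auto simp del: fun_upd_apply)
  next
    case False
    then show ?thesis unfolding subst1_vacuous[OF False] by auto
  qed
next
  case (Ex y \<alpha>)
  show ?case
  proof (cases "x \<in> fv (Ex y \<alpha>)")
    case True
    then have "Var(x := t, y := Var y) = Var(x := t)" by auto
    with True Ex show ?thesis by (auto simp del: fun_upd_apply)
  next
    case False
    then show ?thesis unfolding subst1_vacuous[OF False] by auto
  qed
qed (auto split: if_splits)

text \<open>\<open>inference_on\<close> speaks of formulas only; that \<open>t\<close> is a term of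
  the language has to be recovered from an occurrence of it in
  \<open>subst1 \<alpha> x t\<close>.\<close>

lemma wf_fm_subst_var: "wf_fm L (fm_subst \<sigma> \<alpha>) \<Longrightarrow> x \<in> fv \<alpha> \<Longrightarrow> wf_tm L (\<sigma> x)"
proof (induction \<alpha> arbitrary: \<sigma>)
  case (Atom p ts)
  then show ?case by (auto intro: wf_tm_subst_var)
next
  case (All y \<alpha>)
  then have "wf_tm L ((\<sigma>(y := Var y)) x)" by (intro All.IH) (auto simp del: fun_upd_apply)
  with All.prems show ?case by simp
next
  case (Ex y \<alpha>)
  then have "wf_tm L ((\<sigma>(y := Var y)) x)" by (intro Ex.IH) (auto simp del: fun_upd_apply)
  with Ex.prems show ?case by simp
qed auto

lemma expansion_wf_tm: "expansion L L' \<Longrightarrow> wf_tm L t \<Longrightarrow> wf_tm L' t"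
  by (induction t) (auto simp: expansion_def)


lemma instance_individual:
  assumes "expansion L (language B)" "wf_tm L t" "\<And>z. z \<in> fv_tm t \<Longrightarrow> \<sigma> z \<in> individuals B"
  shows "tm_subst \<sigma> t \<in> individuals B"
  using assms expansion_wf_tm[OF assms(1,2)]
  by (auto simp: individuals_def fv_tm_subst intro!: wf_tm_subst)


subsection \<open>Computation\<close>

inductive_cases eval_DerE: "eval (Der C ds) w"
inductive_cases eval_AndIE: "eval (AndI d e) w"
inductive_cases eval_OrI1E: "eval (OrI1 e) w"
inductive_cases eval_OrI2E: "eval (OrI2 e) w"
inductive_cases eval_ImpIE: "eval (ImpI a) w"
inductive_cases eval_ExIE: "eval (ExI t e) w"
inductive_cases eval_AllIE: "eval (AllI a) w"
inductive_cases eval_AppE: "eval (App a ts es) w"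
inductive_cases eval_OpE: "eval (Op E F ts as) w"
inductive_cases eval_entry_AbsE: "eval_entry (Abs xs zs e) b"

lemma eval_AndI_iff: "eval (AndI d e) w \<longleftrightarrow> (\<exists>v v'. w = AndI v v' \<and> eval d v \<and> eval e v')"
  by (auto elim: eval_AndIE intro: eval_eval_entry.intros)

lemma eval_OrI1_iff: "eval (OrI1 e) w \<longleftrightarrow> (\<exists>v. w = OrI1 v \<and> eval e v)"
  by (auto elim: eval_OrI1E intro: eval_eval_entry.intros)

lemma eval_OrI2_iff: "eval (OrI2 e) w \<longleftrightarrow> (\<exists>v. w = OrI2 v \<and> eval e v)"
  by (auto elim: eval_OrI2E intro: eval_eval_entry.intros)

lemma eval_ImpI_iff: "eval (ImpI a) w \<longleftrightarrow> w = ImpI a"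
  by (auto elim: eval_ImpIE intro: eval_eval_entry.intros)

lemma eval_AllI_iff: "eval (AllI a) w \<longleftrightarrow> w = AllI a"
  by (auto elim: eval_AllIE intro: eval_eval_entry.intros)

lemma eval_ExI_iff: "eval (ExI t e) w \<longleftrightarrow> (\<exists>v. w = ExI t v \<and> eval e v)"
  by (auto elim: eval_ExIE intro: eval_eval_entry.intros)

lemma eval_Der_iff: "eval (Der C ds) w \<longleftrightarrow> (\<exists>vs. w = Der C vs \<and> list_all2 eval ds vs)"
  by (auto elim: eval_DerE intro: eval_eval_entry.intros)

text \<open>Nothing is bound, so the substitution performed by the application is the identity,
  which a closed body survives unchanged.\<close>

lemma eval_App_closed:
  assumes "closed_entry (Abs [] [] e)"
  shows "eval (App (Abs [] [] e) [] []) w \<longleftrightarrow> eval e w"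
proof -
  from assms have "gsubst Var GVar OVar Call e = e"
    by (simp add: closed_entry_def)
  then show ?thesis
    by (auto elim!: eval_AppE intro: eval_eval_entry.intros(8))
qed

lemma eval_entry_Abs_Nil: "eval_entry (Abs [] [] e) b \<longleftrightarrow> (\<exists>v. b = Abs [] [] v \<and> eval e v)"
  by (auto elim: eval_entry_AbsE intro: eval_eval_entry.intros)

lemma eval_entry_Abs: "xs \<noteq> [] \<or> zs \<noteq> [] \<Longrightarrow> eval_entry (Abs xs zs e) b \<longleftrightarrow> b = Abs xs zs e"
  by (auto elim: eval_entry_AbsE intro: eval_eval_entry.intros)

lemma yields_value: "(\<And>w. eval v w \<longleftrightarrow> w = v) \<Longrightarrow> P v \<Longrightarrow> yields v P"
  unfolding yields_def by blast

lemma list_all2_functional: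
  assumes "list_all2 (\<lambda>a v. \<forall>b. R a b \<longleftrightarrow> b = v) as vs"
  shows "list_all2 R as bs \<longleftrightarrow> bs = vs"
  using assms by (induction arbitrary: bs) (auto simp: list_all2_Cons1)

text \<open>The computation is deterministic because all instances that match the computed entries have the
  same right-hand side.\<close>

lemma yields_Op:
  assumes "list_all2 (\<lambda>a v. \<forall>b. eval_entry a b \<longleftrightarrow> b = v) as vs"
    and "Equation F qs ps r \<in> set E" "\<forall>p \<in> set ps. entry_pattern p"
    and "\<forall>x. fv_tm (\<sigma> x) = {}" "\<forall>z. closed_gterm (\<theta> z)" "\<forall>f. closed_entry (\<phi> f)"
    and "map (esubst \<sigma> \<theta> \<phi> Call) ps = vs" "map (tm_subst \<sigma>) qs = ts"
    and unique: "\<And>qs ps r \<sigma>' \<theta>' \<phi>'. Equation F qs ps r \<in> set E \<Longrightarrow>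
      map (esubst \<sigma>' \<theta>' \<phi>' Call) ps = vs \<Longrightarrow> map (tm_subst \<sigma>') qs = ts \<Longrightarrow>
      gsubst \<sigma>' \<theta>' \<phi>' (Op E) r = e"
    and yields: "yields e P"
  shows "yields (Op E F ts as) P"
proof -
  note as = list_all2_functional[OF assms(1)]
  have "eval (Op E F ts as) w \<longleftrightarrow> eval e w" for w
  proof
    assume "eval (Op E F ts as) w"
    then show "eval e w"
    proof (rule eval_OpE)
      fix \<sigma>' \<theta>' \<phi>' ps qs r
      assume "list_all2 eval_entry as (map (esubst \<sigma>' \<theta>' \<phi>' Call) ps)"
        and *: "Equation F qs ps r \<in> set E" "ts = map (tm_subst \<sigma>') qs"
        and ev: "eval (gsubst \<sigma>' \<theta>' \<phi>' (Op E) r) w"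
      \<comment> \<open>The computed entries are determined, so any matching instance has left-hand
        side \<open>vs\<close>; by \<open>unique\<close> its right-hand side is \<open>e\<close>,
        whatever its substitution does to variables foreign to the equation.\<close>
      then have "map (esubst \<sigma>' \<theta>' \<phi>' Call) ps = vs" using as by blast
      with * ev unique show "eval e w" by metis
    qed
  next
    assume "eval e w"
    moreover have "gsubst \<sigma> \<theta> \<phi> (Op E) r = e" using assms by blast
    ultimately show "eval (Op E F ts as) w"
      using assms as by (intro eval_eval_entry.intros(9)[where \<sigma> = \<sigma> and \<theta> = \<theta> and \<phi> = \<phi>]) auto
  qed
  with yields show ?thesis unfolding yields_def by simp
qed


subsection \<open>Grounds are closed values\<close>

text \<open>Schematic variables are replaced by individuals, so the formula recorded at each node is
  closed and no substitution affects it. A derivation contains no application to compute, hence it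
  is its own value.\<close>

lemma derivation_closed_value:
  assumes "derivation B g A"
  shows "closed_gterm g \<and> (\<forall>w. eval g w \<longleftrightarrow> w = g)"
  using assms
proof induction
  case (1 As C \<sigma> ds)
  have ds: "closed_gterm d \<and> (\<forall>w. eval d w \<longleftrightarrow> w = d)" if "d \<in> set ds" for d
    using 1(3) that by (auto simp: list_all2_conv_all_nth in_set_conv_nth)
  have "fv (fm_subst \<sigma> (concl_fm C)) = {z \<in> fv (concl_fm C). \<sigma> z = Var z}"
    using 1(2) by (intro fv_fm_subst_closing) (auto simp: individuals_def)
  \<comment> \<open>An individual is a closed term, hence never a variable.\<close>
  also have "\<dots> = {}" using 1(2) by (force simp: individuals_def)
  finally have "fv (fm_subst \<sigma> (concl_fm C)) = {}" .
  moreover have "map (gsubst \<sigma>' \<theta> \<phi> \<kappa>) ds = ds" for \<sigma>' \<theta> \<phi> \<kappa>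
    using ds by (auto simp: closed_gterm_def intro: map_idI)
  moreover have "list_all2 eval ds vs \<longleftrightarrow> vs = ds" for vs
    using ds by (intro list_all2_functional) (auto simp: list_all2_conv_all_nth)
  ultimately show ?case
    by (auto simp: closed_gterm_def eval_Der_iff fm_subst_closed)
qed

lemma closed_gterm_simps [simp]:
  "closed_gterm (AndI d e) \<longleftrightarrow> closed_gterm d \<and> closed_gterm e"
  "closed_gterm (OrI1 d) \<longleftrightarrow> closed_gterm d"
  "closed_gterm (OrI2 d) \<longleftrightarrow> closed_gterm d"
  "closed_gterm (ImpI a) \<longleftrightarrow> closed_entry a"
  "closed_gterm (AllI a) \<longleftrightarrow> closed_entry a"
  "closed_gterm (ExI None d) \<longleftrightarrow> closed_gterm d"
  "fv_tm t = {} \<Longrightarrow> closed_gterm (ExI (Some t) d) \<longleftrightarrow> closed_gterm d"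
  "closed_entry (Abs [] [] d) \<longleftrightarrow> closed_gterm d"
  by (auto simp: closed_gterm_def closed_entry_def)

text \<open>The components of a ground for an atom, \<open>\<and>\<close>, \<open>\<or>\<close> or
  \<open>\<exists>\<close> are grounds already, and below \<open>ImpI\<close> and
  \<open>AllI\<close> computation stops at a closed operation. Closedness lets grounds be
  substituted for pattern variables; being its own value makes the matching of a ground
  deterministic.\<close>

lemma ground_closed_value:
  "ground B \<alpha> g \<Longrightarrow> closed_gterm g \<and> (\<forall>w. eval g w \<longleftrightarrow> w = g)"
proof (induction B \<alpha> g rule: ground.induct)
  case (2 B p ts g)
  then show ?case using derivation_closed_value by auto
next
  case (3 B \<alpha> \<beta> g)
  from "3.prems" obtain h k where "g = AndI h k" "ground B \<alpha> h" "ground B \<beta> k" by auto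
  with "3.IH" show ?case by (auto simp: eval_AndI_iff)
next
  case (4 B \<alpha> \<beta> g)
  from "4.prems" consider h where "g = OrI1 h" "ground B \<alpha> h" | h where "g = OrI2 h" "ground B \<beta> h"
    by auto
  then show ?case by cases (auto simp: eval_OrI1_iff eval_OrI2_iff "4.IH")
next
  case (5 B \<alpha> \<beta> g)
  from "5.prems" show ?case by (auto simp: eval_ImpI_iff simp del: closed_gterm_simps(8))
next
  case (6 B x \<alpha> g)
  show ?case
  proof (cases "x \<in> fv \<alpha>")
    case True
    with "6.prems" obtain t h where h: "g = ExI (Some t) h" "t \<in> individuals B" "ground B (subst1 \<alpha> x t) h"
      by auto
    with "6.IH"(1)[OF True] have "closed_gterm h \<and> (\<forall>w. eval h w \<longleftrightarrow> w = h)" by blast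
    with h show ?thesis by (auto simp: eval_ExI_iff individuals_def)
  next
    case False
    with "6.prems" obtain h where h: "g = ExI None h" "ground B \<alpha> h" by auto
    with "6.IH"(2)[OF False] have "closed_gterm h \<and> (\<forall>w. eval h w \<longleftrightarrow> w = h)" by blast
    with h show ?thesis by (auto simp: eval_ExI_iff)
  qed
next
  case (7 B x \<alpha> g)
  then obtain a where "g = AllI a" "closed_entry a" by (cases "x \<in> fv \<alpha>") auto
  then show ?case by (auto simp: eval_AllI_iff)
qed simp

lemma ground_closed: "ground B \<alpha> g \<Longrightarrow> closed_gterm g"
  and ground_value: "ground B \<alpha> g \<Longrightarrow> eval g w \<longleftrightarrow> w = g"
  using ground_closed_value by blast+

lemma yields_ground: "ground B \<alpha> g \<Longrightarrow> yields g (ground B \<alpha>)"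
  using ground_value by (intro yields_value) auto

lemma closed_entry_ground: "ground B \<alpha> g \<Longrightarrow> closed_entry (Abs [] [] g)"
  using ground_closed by (simp add: closed_gterm_def closed_entry_def)

lemma yields_App_ground: "ground B \<alpha> v \<Longrightarrow> yields (App (Abs [] [] v) [] []) (ground B \<alpha>)"
  using eval_App_closed[OF closed_entry_ground] yields_ground[of B \<alpha> v] by (simp add: yields_def)

text \<open>A vacuously bound variable is no argument of a first-level operation, so such an entry is
  computed like one on which nothing is bound.\<close>

lemma first_level_unbound:
  assumes "first_level B \<sigma> (X, [], \<alpha>) a" "set X \<inter> fv \<alpha> = {}"
  obtains v where "\<forall>b. eval_entry a b \<longleftrightarrow> b = Abs [] [] v" "ground B (fm_subst \<sigma> \<alpha>) v"
proof -
  have X: "filter (\<lambda>x. x \<in> fv \<alpha>) X = []"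
    using assms(2) by (auto simp: filter_empty_conv)
  with assms(1) obtain e where e: "a = Abs [] [] e" "closed_entry a"
    and y: "yields (App a [] []) (ground B (fm_subst \<sigma> \<alpha>))"
    by (auto simp: Let_def)
  then show ?thesis
    using that by (auto simp: yields_def eval_App_closed eval_entry_Abs_Nil)
qed

text \<open>The case complementary to a vacuous binding: the abstraction really binds something, a
  ground variable for a discharged assumption or an individual variable free in
  \<open>\<alpha>\<close>. \<open>eval_entry\<close> leaves such an entry as it is, so equations
  take it by an entry variable.\<close>

lemma first_level_bound:
  assumes "first_level B \<sigma> (X, \<Gamma>, \<alpha>) a" "\<Gamma> \<noteq> [] \<or> set X \<inter> fv \<alpha> \<noteq> {}"
  shows "\<forall>b. eval_entry a b \<longleftrightarrow> b = a" "closed_entry a"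
proof -
  define X' where "X' = filter (\<lambda>x. x \<in> (\<Union>\<gamma> \<in> set \<Gamma>. fv \<gamma>) \<union> fv \<alpha>) X"
  from assms(1) obtain ys zs e where a: "a = Abs ys zs e" "length ys = length X'"
    "length zs = length \<Gamma>" and cl: "closed_entry a"
    by (auto simp: Let_def X'_def)
  have "\<Gamma> \<noteq> [] \<or> X' \<noteq> []"
    using assms(2) by (auto simp: X'_def filter_empty_conv)
  with a have "ys \<noteq> [] \<or> zs \<noteq> []" by auto
  then show "\<forall>b. eval_entry a b \<longleftrightarrow> b = a" using a(1) eval_entry_Abs by blast
  show "closed_entry a" by (fact cl)
qed

text \<open>The list of variables that remain arguments is a parameter, so that each rule can
  determine it beforehand. With the two lemmas before it, this is all that is used about
  \<open>first_level\<close> from here on.\<close>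

lemma first_level_AbsE:
  assumes "first_level B \<sigma> (X, \<Gamma>, \<alpha>) a"
    and "filter (\<lambda>x. x \<in> (\<Union>\<gamma> \<in> set \<Gamma>. fv \<gamma>) \<union> fv \<alpha>) X = X'"
  obtains ys zs e where "a = Abs ys zs e" "length ys = length X'" "length zs = length \<Gamma>"
    "closed_entry a"
    "\<And>ts hs. \<lbrakk>length ts = length X'; set ts \<subseteq> individuals B;
       list_all2 (\<lambda>\<gamma> h. ground B (fm_subst (upd \<sigma> X' ts) \<gamma>) h) \<Gamma> hs\<rbrakk>
       \<Longrightarrow> yields (App a ts hs) (ground B (fm_subst (upd \<sigma> X' ts) \<alpha>))"
  using assms by (auto simp: Let_def)

declare first_level.simps [simp del]

section \<open>Grounds for instances of quantified formulas\<close>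

text \<open>\<open>ground\<close> decides vacuity and takes instances on the instantiated body. As
  \<open>\<sigma>\<close> is closing away from \<open>x\<close>, both can be read off
  \<open>\<alpha>\<close> itself, which is where the equations of the quantifier rules make their
  case distinction.\<close>

lemma ground_All:
  assumes "\<forall>z \<in> fv (All x \<alpha>). \<sigma> z \<in> individuals B"
  shows "ground B (fm_subst \<sigma> (All x \<alpha>)) g \<longleftrightarrow>
    (if x \<in> fv \<alpha>
     then \<exists>y e. g = AllI (Abs [y] [] e) \<and> closed_entry (Abs [y] [] e) \<and>
       (\<forall>t \<in> individuals B. yields (App (Abs [y] [] e) [t] []) (ground B (fm_subst (\<sigma>(x := t)) \<alpha>)))
     else \<exists>e. g = AllI (Abs [] [] e) \<and> closed_entry (Abs [] [] e) \<and>
       yields (App (Abs [] [] e) [] []) (ground B (fm_subst \<sigma> \<alpha>)))"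
proof -
  have closed: "fv_tm (\<sigma> z) = {}" if "z \<in> fv \<alpha> - {x}" for z
    using assms that by (auto simp: individuals_def)
  then have "fv (fm_subst (\<sigma>(x := Var x)) \<alpha>) = {z \<in> fv \<alpha>. (\<sigma>(x := Var x)) z = Var z}"
    by (intro fv_fm_subst_closing) auto
  \<comment> \<open>\<open>x\<close> is kept and closed terms contribute no variable, so the
    quantifier is vacuous after instantiation iff it was before.\<close>
  then have x: "x \<in> fv (fm_subst (\<sigma>(x := Var x)) \<alpha>) \<longleftrightarrow> x \<in> fv \<alpha>" by auto
  show ?thesis
  proof (cases "x \<in> fv \<alpha>")
    case True
    have inst: "subst1 (fm_subst (\<sigma>(x := Var x)) \<alpha>) x t = fm_subst (\<sigma>(x := t)) \<alpha>" for t
      by (intro subst1_fm_subst closed)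
    from x True show ?thesis by (simp add: inst del: fun_upd_apply)
  next
    case False
    then have "fm_subst (\<sigma>(x := Var x)) \<alpha> = fm_subst \<sigma> \<alpha>" by (intro fm_subst_cong) auto
    with x False show ?thesis by (simp del: fun_upd_apply)
  qed
qed

lemma ground_Ex:
  assumes "\<forall>z \<in> fv (Ex x \<alpha>). \<sigma> z \<in> individuals B"
  shows "ground B (fm_subst \<sigma> (Ex x \<alpha>)) g \<longleftrightarrow>
    (if x \<in> fv \<alpha>
     then \<exists>t h. g = ExI (Some t) h \<and> t \<in> individuals B \<and> ground B (fm_subst (\<sigma>(x := t)) \<alpha>) h
     else \<exists>h. g = ExI None h \<and> ground B (fm_subst \<sigma> \<alpha>) h)"
proof -
  have closed: "fv_tm (\<sigma> z) = {}" if "z \<in> fv \<alpha> - {x}" for z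
    using assms that by (auto simp: individuals_def)
  then have "fv (fm_subst (\<sigma>(x := Var x)) \<alpha>) = {z \<in> fv \<alpha>. (\<sigma>(x := Var x)) z = Var z}"
    by (intro fv_fm_subst_closing) auto
  then have x: "x \<in> fv (fm_subst (\<sigma>(x := Var x)) \<alpha>) \<longleftrightarrow> x \<in> fv \<alpha>" by auto
  show ?thesis
  proof (cases "x \<in> fv \<alpha>")
    case True
    have inst: "subst1 (fm_subst (\<sigma>(x := Var x)) \<alpha>) x t = fm_subst (\<sigma>(x := t)) \<alpha>" for t
      by (intro subst1_fm_subst closed)
    from x True show ?thesis by (simp add: inst del: fun_upd_apply)
  next
    case False
    then have "fm_subst (\<sigma>(x := Var x)) \<alpha> = fm_subst \<sigma> \<alpha>" by (intro fm_subst_cong) auto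
    with x False show ?thesis by (simp del: fun_upd_apply)
  qed
qed

text \<open>Giving the eigenvariable the value \<open>t\<close> in the premise amounts to giving it
  to \<open>x\<close> in \<open>\<alpha>\<close>. The proviso excludes \<open>x\<close> because
  \<open>y\<close> may be \<open>x\<close> itself.\<close>

lemma fm_subst_eigenvariable:
  assumes "free_for (Var y) x \<alpha>" "y \<notin> fv \<alpha> - {x}"
  shows "fm_subst (\<sigma>(y := t)) (subst1 \<alpha> x (Var y)) = fm_subst (\<sigma>(x := t)) \<alpha>"
  unfolding fm_subst_subst1[OF assms(1)] using assms(2) by (intro fm_subst_cong) auto


subsection \<open>Validity of the rules\<close>

text \<open>Since \<open>ground_identical\<close> is equality of codes, one code that works
  uniformly on all bases over expansions of \<open>L\<close> is its own counterpart on each of them.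
  The condition on \<open>xs\<close> is what \<open>proper_ground\<close> adds to being an
  operation.\<close>

lemma logically_validI:
  assumes "inference_on L (\<tau>s, \<beta>)" "set xs \<subseteq> fv_type (\<tau>s, \<beta>)"
    and yields: "\<And>B \<sigma> as. \<lbrakk>expansion L (language B);
        \<And>x. x \<in> fv_type (\<tau>s, \<beta>) \<Longrightarrow> \<sigma> x \<in> individuals B;
        list_all2 (first_level B \<sigma>) \<tau>s as\<rbrakk>
      \<Longrightarrow> yields (Op E F (map \<sigma> xs) as) (ground B (fm_subst \<sigma> \<beta>))"
  shows "logically_valid L (\<tau>s, \<beta>)"
proof -
  have proper: "proper_ground B (\<tau>s, \<beta>) (E, F, xs)" if "expansion L (language B)" for B
    using assms(2) yields[OF that] by (auto simp del: fv_type.simps)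
  define B where "B = \<lparr>language = L, rules = {}\<rparr>"
  \<comment> \<open>The constant \<open>Zero\<close> is the characteristic function of the empty set
    of rules.\<close>
  have "recursive_set {}"
    unfolding recursive_set_def by (auto intro!: exI[of _ Zero] recf_eval.intros)
  then have "atomic_base B" "language B = L"
    by (simp_all add: atomic_base_def B_def)
  moreover have "universal_ground B (\<tau>s, \<beta>) (E, F, xs)"
    unfolding universal_ground_def ground_identical_def \<open>language B = L\<close>
    using proper proper[of B] \<open>language B = L\<close> by (simp only: expansion_def) blast
  ultimately show ?thesis
    using assms(1) unfolding logically_valid_def by blast
qed

section \<open>Propositional rules\<close>

lemma valid_AndI:
  assumes "inference_on L ([([], [], \<alpha>), ([], [], \<beta>)], (And \<alpha> \<beta>))"
  shows "logically_valid L ([([], [], \<alpha>), ([], [], \<beta>)], (And \<alpha> \<beta>))"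
proof -
  let ?E = "[Equation 0 [] [Abs [] [] (GVar 0), Abs [] [] (GVar 1)] (AndI (GVar 0) (GVar 1))]"
  show ?thesis
  proof (rule logically_validI[OF assms, where E = ?E and F = 0 and xs = "[]"])
    fix B \<sigma> as
    assume "list_all2 (first_level B \<sigma>) [([], [], \<alpha>), ([], [], \<beta>)] as"
    then obtain a b where as: "as = [a, b]"
      and a: "first_level B \<sigma> ([], [], \<alpha>) a" and b: "first_level B \<sigma> ([], [], \<beta>) b"
      by (auto simp: list_all2_Cons1)
    from a obtain v where v: "\<forall>c. eval_entry a c \<longleftrightarrow> c = Abs [] [] v" "ground B (fm_subst \<sigma> \<alpha>) v"
      by (rule first_level_unbound) auto
    from b obtain w where w: "\<forall>c. eval_entry b c \<longleftrightarrow> c = Abs [] [] w" "ground B (fm_subst \<sigma> \<beta>) w"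
      by (rule first_level_unbound) auto
    from v(2) w(2) have "ground B (fm_subst \<sigma> (And \<alpha> \<beta>)) (AndI v w)" by auto
    note yields_ground[OF this]
    \<comment> \<open>\<open>yields_Op\<close> asks for closed values at every variable, also at
      those foreign to the equation. \<open>Fn 0 []\<close> is an arbitrary closed term,
      \<open>\<phi>\<close> is a filler, and \<open>\<theta>\<close> matters at 0 and 1
      only.\<close>
    show "yields (Op ?E 0 (map \<sigma> []) as) (ground B (fm_subst \<sigma> (And \<alpha> \<beta>)))"
      using v w ground_closed[OF v(2)] ground_closed[OF w(2)] \<open>yields (AndI v w) _\<close>
      by (intro yields_Op[OF _ list.set_intros(1), where vs = "[Abs [] [] v, Abs [] [] w]"
          and \<sigma> = "\<lambda>_. Fn 0 []" and \<theta> = "\<lambda>z. if z = 0 then v else w" and \<phi> = "\<lambda>_. Abs [] [] v"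
          and e = "AndI v w"]) (auto simp: as)
  qed simp
qed

text \<open>The computed premise is literally a pair, so the pattern always matches and determines
  both ground variables; the operation is the first projection.\<close>

lemma valid_AndE1:
  assumes "inference_on L ([([], [], And \<alpha> \<beta>)], \<alpha>)"
  shows "logically_valid L ([([], [], And \<alpha> \<beta>)], \<alpha>)"
proof -
  let ?E = "[Equation 0 [] [Abs [] [] (AndI (GVar 0) (GVar 1))] (GVar 0)]"
  show ?thesis
  proof (rule logically_validI[OF assms, where E = ?E and F = 0 and xs = "[]"])
    fix B \<sigma> as
    assume "list_all2 (first_level B \<sigma>) [([], [], And \<alpha> \<beta>)] as"
    then obtain a where as: "as = [a]"
      and a: "first_level B \<sigma> ([], [], And \<alpha> \<beta>) a"
      by (auto simp: list_all2_Cons1)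
    from a obtain u where u: "\<forall>c. eval_entry a c \<longleftrightarrow> c = Abs [] [] u" "ground B (fm_subst \<sigma> (And \<alpha> \<beta>)) u"
      by (rule first_level_unbound) auto
    from u(2) obtain v w where vw: "u = AndI v w" "ground B (fm_subst \<sigma> \<alpha>) v" "ground B (fm_subst \<sigma> \<beta>) w" by auto
    show "yields (Op ?E 0 (map \<sigma> []) as) (ground B (fm_subst \<sigma> \<alpha>))"
      using u(1) vw ground_closed[OF vw(2)] ground_closed[OF vw(3)] yields_ground[OF vw(2)]
      by (intro yields_Op[OF _ list.set_intros(1), where vs = "[Abs [] [] (AndI v w)]"
          and \<sigma> = "\<lambda>_. Fn 0 []" and \<theta> = "\<lambda>z. if z = 0 then v else w" and \<phi> = "\<lambda>_. Abs [] [] v"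
          and e = "v"]) (auto simp: as)
  qed simp
qed

lemma valid_AndE2:
  assumes "inference_on L ([([], [], And \<alpha> \<beta>)], \<beta>)"
  shows "logically_valid L ([([], [], And \<alpha> \<beta>)], \<beta>)"
proof -
  let ?E = "[Equation 0 [] [Abs [] [] (AndI (GVar 0) (GVar 1))] (GVar 1)]"
  show ?thesis
  proof (rule logically_validI[OF assms, where E = ?E and F = 0 and xs = "[]"])
    fix B \<sigma> as
    assume "list_all2 (first_level B \<sigma>) [([], [], And \<alpha> \<beta>)] as"
    then obtain a where as: "as = [a]"
      and a: "first_level B \<sigma> ([], [], And \<alpha> \<beta>) a"
      by (auto simp: list_all2_Cons1)
    from a obtain u where u: "\<forall>c. eval_entry a c \<longleftrightarrow> c = Abs [] [] u" "ground B (fm_subst \<sigma> (And \<alpha> \<beta>)) u"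
      by (rule first_level_unbound) auto
    from u(2) obtain v w where vw: "u = AndI v w" "ground B (fm_subst \<sigma> \<alpha>) v" "ground B (fm_subst \<sigma> \<beta>) w" by auto
    show "yields (Op ?E 0 (map \<sigma> []) as) (ground B (fm_subst \<sigma> \<beta>))"
      using u(1) vw ground_closed[OF vw(2)] ground_closed[OF vw(3)] yields_ground[OF vw(3)]
      by (intro yields_Op[OF _ list.set_intros(1), where vs = "[Abs [] [] (AndI v w)]"
          and \<sigma> = "\<lambda>_. Fn 0 []" and \<theta> = "\<lambda>z. if z = 0 then v else w" and \<phi> = "\<lambda>_. Abs [] [] v"
          and e = "w"]) (auto simp: as)
  qed simp
qed

lemma valid_OrI1:
  assumes "inference_on L ([([], [], \<alpha>)], (Or \<alpha> \<beta>))"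
  shows "logically_valid L ([([], [], \<alpha>)], (Or \<alpha> \<beta>))"
proof -
  let ?E = "[Equation 0 [] [Abs [] [] (GVar 0)] (OrI1 (GVar 0))]"
  show ?thesis
  proof (rule logically_validI[OF assms, where E = ?E and F = 0 and xs = "[]"])
    fix B \<sigma> as
    assume "list_all2 (first_level B \<sigma>) [([], [], \<alpha>)] as"
    then obtain a where as: "as = [a]"
      and a: "first_level B \<sigma> ([], [], \<alpha>) a"
      by (auto simp: list_all2_Cons1)
    from a obtain v where v: "\<forall>c. eval_entry a c \<longleftrightarrow> c = Abs [] [] v" "ground B (fm_subst \<sigma> \<alpha>) v"
      by (rule first_level_unbound) auto
    from v(2) have g: "ground B (fm_subst \<sigma> (Or \<alpha> \<beta>)) (OrI1 v)" by auto
    show "yields (Op ?E 0 (map \<sigma> []) as) (ground B (fm_subst \<sigma> (Or \<alpha> \<beta>)))"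
      using v ground_closed[OF v(2)] yields_ground[OF g]
      by (intro yields_Op[OF _ list.set_intros(1), where vs = "[Abs [] [] v]"
          and \<sigma> = "\<lambda>_. Fn 0 []" and \<theta> = "\<lambda>_. v" and \<phi> = "\<lambda>_. Abs [] [] v"
          and e = "OrI1 v"]) (auto simp: as)
  qed simp
qed

lemma valid_OrI2:
  assumes "inference_on L ([([], [], \<beta>)], (Or \<alpha> \<beta>))"
  shows "logically_valid L ([([], [], \<beta>)], (Or \<alpha> \<beta>))"
proof -
  let ?E = "[Equation 0 [] [Abs [] [] (GVar 0)] (OrI2 (GVar 0))]"
  show ?thesis
  proof (rule logically_validI[OF assms, where E = ?E and F = 0 and xs = "[]"])
    fix B \<sigma> as
    assume "list_all2 (first_level B \<sigma>) [([], [], \<beta>)] as"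
    then obtain a where as: "as = [a]"
      and a: "first_level B \<sigma> ([], [], \<beta>) a"
      by (auto simp: list_all2_Cons1)
    from a obtain v where v: "\<forall>c. eval_entry a c \<longleftrightarrow> c = Abs [] [] v" "ground B (fm_subst \<sigma> \<beta>) v"
      by (rule first_level_unbound) auto
    from v(2) have g: "ground B (fm_subst \<sigma> (Or \<alpha> \<beta>)) (OrI2 v)" by auto
    show "yields (Op ?E 0 (map \<sigma> []) as) (ground B (fm_subst \<sigma> (Or \<alpha> \<beta>)))"
      using v ground_closed[OF v(2)] yields_ground[OF g]
      by (intro yields_Op[OF _ list.set_intros(1), where vs = "[Abs [] [] v]"
          and \<sigma> = "\<lambda>_. Fn 0 []" and \<theta> = "\<lambda>_. v" and \<phi> = "\<lambda>_. Abs [] [] v"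
          and e = "OrI2 v"]) (auto simp: as)
  qed simp
qed

lemma valid_BotE:
  assumes "inference_on L ([([], [], Bot)], \<alpha>)"
  shows "logically_valid L ([([], [], Bot)], \<alpha>)"
proof -
  \<comment> \<open>No equation is called for: \<open>Bot\<close> has no grounds, so there is no
    argument at which a value would be due.\<close>
  let ?E = "[]"
  show ?thesis
  proof (rule logically_validI[OF assms, where E = ?E and F = 0 and xs = "[]"])
    fix B \<sigma> as
    assume "list_all2 (first_level B \<sigma>) [([], [], Bot)] as"
    then obtain a where as: "as = [a]"
      and a: "first_level B \<sigma> ([], [], Bot) a"
      by (auto simp: list_all2_Cons1)
    from a obtain v where v: "\<forall>c. eval_entry a c \<longleftrightarrow> c = Abs [] [] v" "ground B (fm_subst \<sigma> Bot) v"
      by (rule first_level_unbound) auto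
    show "yields (Op ?E 0 (map \<sigma> []) as) (ground B (fm_subst \<sigma> \<alpha>))"
      using v(2) by simp
  qed simp
qed

lemma valid_ImpI:
  assumes "inference_on L ([([], [\<alpha>], \<beta>)], (Imp \<alpha> \<beta>))"
  shows "logically_valid L ([([], [\<alpha>], \<beta>)], (Imp \<alpha> \<beta>))"
proof -
  let ?E = "[Equation 0 [] [OVar 0] (ImpI (OVar 0))]"
  show ?thesis
  proof (rule logically_validI[OF assms, where E = ?E and F = 0 and xs = "[]"])
    fix B \<sigma> as
    assume "list_all2 (first_level B \<sigma>) [([], [\<alpha>], \<beta>)] as"
    then obtain a where as: "as = [a]"
      and a: "first_level B \<sigma> ([], [\<alpha>], \<beta>) a"
      by (auto simp: list_all2_Cons1)
    \<comment> \<open>One discharged assumption and no bound individual variable: the entry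
      abstracts over exactly one ground variable, the form that \<open>ground\<close> prescribes
      below \<open>ImpI\<close>.\<close>
    from a obtain z e where e: "a = Abs [] [z] e" "closed_entry a"
      "\<And>h. ground B (fm_subst \<sigma> \<alpha>) h \<Longrightarrow> yields (App a [] [h]) (ground B (fm_subst \<sigma> \<beta>))"
      by (rule first_level_AbsE[where X' = "[]"]) (auto simp: length_Suc_conv)
    note val = first_level_bound(1)[OF a]
    from e have g: "ground B (fm_subst \<sigma> (Imp \<alpha> \<beta>)) (ImpI a)" by auto
    show "yields (Op ?E 0 (map \<sigma> []) as) (ground B (fm_subst \<sigma> (Imp \<alpha> \<beta>)))"
      using val e(2) yields_ground[OF g]
      by (intro yields_Op[OF _ list.set_intros(1), where vs = "[a]"
          and \<sigma> = "\<lambda>_. Fn 0 []" and \<theta> = "\<lambda>_. ImpI a" and \<phi> = "\<lambda>_. a"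
          and e = "ImpI a"]) (auto simp: as)
  qed simp
qed

text \<open>Matching binds \<open>OVar 0\<close> to the operation stored in the canonical ground; by
  the clause for \<open>Imp\<close>, its application to a ground for \<open>\<alpha>\<close> yields
  one for \<open>\<beta>\<close>.\<close>

lemma valid_ImpE:
  assumes "inference_on L ([([], [], Imp \<alpha> \<beta>), ([], [], \<alpha>)], \<beta>)"
  shows "logically_valid L ([([], [], Imp \<alpha> \<beta>), ([], [], \<alpha>)], \<beta>)"
proof -
  let ?E = "[Equation 0 [] [Abs [] [] (ImpI (OVar 0)), Abs [] [] (GVar 0)] (App (OVar 0) [] [GVar 0])]"
  show ?thesis
  proof (rule logically_validI[OF assms, where E = ?E and F = 0 and xs = "[]"])
    fix B \<sigma> as
    assume "list_all2 (first_level B \<sigma>) [([], [], Imp \<alpha> \<beta>), ([], [], \<alpha>)] as"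
    then obtain a b where as: "as = [a, b]"
      and a: "first_level B \<sigma> ([], [], Imp \<alpha> \<beta>) a" and b: "first_level B \<sigma> ([], [], \<alpha>) b"
      by (auto simp: list_all2_Cons1)
    from a obtain u where u: "\<forall>c. eval_entry a c \<longleftrightarrow> c = Abs [] [] u" "ground B (fm_subst \<sigma> (Imp \<alpha> \<beta>)) u"
      by (rule first_level_unbound) auto
    from b obtain v where v: "\<forall>c. eval_entry b c \<longleftrightarrow> c = Abs [] [] v" "ground B (fm_subst \<sigma> \<alpha>) v"
      by (rule first_level_unbound) auto
    from u(2) v(2) obtain c where c: "u = ImpI c" "closed_entry c" "yields (App c [] [v]) (ground B (fm_subst \<sigma> \<beta>))" by auto
    show "yields (Op ?E 0 (map \<sigma> []) as) (ground B (fm_subst \<sigma> \<beta>))"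
      using u(1) v(1) c ground_closed[OF v(2)]
      by (intro yields_Op[OF _ list.set_intros(1), where vs = "[Abs [] [] (ImpI c), Abs [] [] v]"
          and \<sigma> = "\<lambda>_. Fn 0 []" and \<theta> = "\<lambda>_. v" and \<phi> = "\<lambda>_. c"
          and e = "App c [] [v]"]) (auto simp: as)
  qed simp
qed

text \<open>One equation for each disjunct. The constructor of the computed major premise decides
  which of them matches, and both minor premises are passed on uncomputed.\<close>

lemma valid_OrE:
  assumes "inference_on L ([([], [], Or \<alpha> \<beta>), ([], [\<alpha>], \<gamma>), ([], [\<beta>], \<gamma>)], \<gamma>)"
  shows "logically_valid L ([([], [], Or \<alpha> \<beta>), ([], [\<alpha>], \<gamma>), ([], [\<beta>], \<gamma>)], \<gamma>)"
proof -
  let ?E = "[Equation 0 [] [Abs [] [] (OrI1 (GVar 0)), OVar 0, OVar 1] (App (OVar 0) [] [GVar 0]),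
    Equation 0 [] [Abs [] [] (OrI2 (GVar 0)), OVar 0, OVar 1] (App (OVar 1) [] [GVar 0])]"
  show ?thesis
  proof (rule logically_validI[OF assms, where E = ?E and F = 0 and xs = "[]"])
    fix B \<sigma> as
    assume "list_all2 (first_level B \<sigma>) [([], [], Or \<alpha> \<beta>), ([], [\<alpha>], \<gamma>), ([], [\<beta>], \<gamma>)] as"
    then obtain a b c where as: "as = [a, b, c]"
      and a: "first_level B \<sigma> ([], [], Or \<alpha> \<beta>) a" and b: "first_level B \<sigma> ([], [\<alpha>], \<gamma>) b" and c: "first_level B \<sigma> ([], [\<beta>], \<gamma>) c"
      by (auto simp: list_all2_Cons1)
    from a obtain u where u: "\<forall>c. eval_entry a c \<longleftrightarrow> c = Abs [] [] u" "ground B (fm_subst \<sigma> (Or \<alpha> \<beta>)) u"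
      by (rule first_level_unbound) auto
    from b have b': "\<And>h. ground B (fm_subst \<sigma> \<alpha>) h \<Longrightarrow> yields (App b [] [h]) (ground B (fm_subst \<sigma> \<gamma>))"
      by (rule first_level_AbsE[where X' = "[]"]) auto
    from c have c': "\<And>h. ground B (fm_subst \<sigma> \<beta>) h \<Longrightarrow> yields (App c [] [h]) (ground B (fm_subst \<sigma> \<gamma>))"
      by (rule first_level_AbsE[where X' = "[]"]) auto
    have vals: "\<forall>d. eval_entry b d \<longleftrightarrow> d = b" "closed_entry b" "\<forall>d. eval_entry c d \<longleftrightarrow> d = c" "closed_entry c"
      using first_level_bound[OF b] first_level_bound[OF c] by auto
    from u(2) consider v where "u = OrI1 v" "ground B (fm_subst \<sigma> \<alpha>) v"
      | v where "u = OrI2 v" "ground B (fm_subst \<sigma> \<beta>) v" by auto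
    then show "yields (Op ?E 0 (map \<sigma> []) as) (ground B (fm_subst \<sigma> \<gamma>))"
    proof cases
      case (1 v)
      \<comment> \<open>For \<open>unique\<close> either equation has to be considered: the first
        determines \<open>e\<close>, and the second cannot match because \<open>OrI1\<close> and
        \<open>OrI2\<close> clash.\<close>
      show ?thesis
        using u(1) vals 1 ground_closed[OF 1(2)] b'[OF 1(2)]
        by (intro yields_Op[OF _ list.set_intros(1), where vs = "[Abs [] [] (OrI1 v), b, c]"
            and \<sigma> = "\<lambda>_. Fn 0 []" and \<theta> = "\<lambda>_. v" and \<phi> = "\<lambda>f. if f = 0 then b else c"
            and e = "App b [] [v]"]) (simp_all add: as, erule disjE, simp_all)
    next
      case (2 v)
      show ?thesis
        using u(1) vals 2 ground_closed[OF 2(2)] c'[OF 2(2)]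
        by (intro yields_Op[OF _ list.set_intros(2)[OF list.set_intros(1)], where vs = "[Abs [] [] (OrI2 v), b, c]"
            and \<sigma> = "\<lambda>_. Fn 0 []" and \<theta> = "\<lambda>_. v" and \<phi> = "\<lambda>f. if f = 0 then b else c"
            and e = "App c [] [v]"]) (simp_all add: as, erule disjE, simp_all)
    qed
  qed simp
qed

section \<open>Quantifier rules\<close>

lemma valid_AllI:
  assumes "inference_on L ([([y], [], subst1 \<alpha> x (Var y))], All x \<alpha>)"
    and free: "free_for (Var y) x \<alpha>" and y: "y \<notin> fv (All x \<alpha>)"
  shows "logically_valid L ([([y], [], subst1 \<alpha> x (Var y))], All x \<alpha>)"
proof -
  let ?E = "[Equation 0 [] [OVar 0] (AllI (OVar 0))]"
  show ?thesis
  proof (rule logically_validI[OF assms(1), where E = ?E and F = 0 and xs = "[]"])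
    fix B \<sigma> as
    assume \<sigma>: "\<And>z. z \<in> fv_type ([([y], [], subst1 \<alpha> x (Var y))], All x \<alpha>) \<Longrightarrow> \<sigma> z \<in> individuals B"
      and "list_all2 (first_level B \<sigma>) [([y], [], subst1 \<alpha> x (Var y))] as"
    then obtain a where as: "as = [a]" and a: "first_level B \<sigma> ([y], [], subst1 \<alpha> x (Var y)) a"
      by (auto simp: list_all2_Cons1)
    have \<sigma>': "\<forall>z \<in> fv (All x \<alpha>). \<sigma> z \<in> individuals B"
      using \<sigma> by simp
    \<comment> \<open>The operation to be stored below \<open>AllI\<close> is the entry
      \<open>a\<close> itself if \<open>x\<close> is free in \<open>\<alpha>\<close>. Otherwise
      \<open>y\<close> is bound vacuously, and the entry is first computed to some
      \<open>Abs [] [] v\<close>. The variable \<open>OVar 0\<close> matches either form, so one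
      equation covers both.\<close>
    obtain c where c: "\<forall>d. eval_entry a d \<longleftrightarrow> d = c" "closed_entry c"
      and g: "ground B (fm_subst \<sigma> (All x \<alpha>)) (AllI c)"
    proof (cases "x \<in> fv \<alpha>")
      case True
      then have fv: "y \<in> fv (subst1 \<alpha> x (Var y))" by (simp add: fv_subst1[OF free])
      then have "filter (\<lambda>z. z \<in> (\<Union>\<delta> \<in> set []. fv \<delta>) \<union> fv (subst1 \<alpha> x (Var y))) [y] = [y]" by simp
      from a this obtain ys zs e where "a = Abs ys zs e" "length ys = length [y]" "length zs = length ([] :: fm list)"
        and cl: "closed_entry a"
        and app: "\<And>ts hs. \<lbrakk>length ts = length [y]; set ts \<subseteq> individuals B;
          list_all2 (\<lambda>\<gamma> h. ground B (fm_subst (upd \<sigma> [y] ts) \<gamma>) h) [] hs\<rbrakk>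
          \<Longrightarrow> yields (App a ts hs) (ground B (fm_subst (upd \<sigma> [y] ts) (subst1 \<alpha> x (Var y))))"
        by (rule first_level_AbsE) blast
      then obtain z where z: "a = Abs [z] [] e" by (auto simp: length_Suc_conv)
      have e: "yields (App a [t] []) (ground B (fm_subst (\<sigma>(y := t)) (subst1 \<alpha> x (Var y))))"
        if "t \<in> individuals B" for t
        using app[of "[t]" "[]"] that by (simp del: fun_upd_apply)
      have "fm_subst (\<sigma>(y := t)) (subst1 \<alpha> x (Var y)) = fm_subst (\<sigma>(x := t)) \<alpha>" for t
        using y by (intro fm_subst_eigenvariable[OF free]) simp
      with e cl z True have "ground B (fm_subst \<sigma> (All x \<alpha>)) (AllI a)"
        unfolding ground_All[OF \<sigma>'] by (simp del: fun_upd_apply)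
      moreover have "\<forall>d. eval_entry a d \<longleftrightarrow> d = a"
        using first_level_bound(1)[OF a] fv by auto
      ultimately show ?thesis using that cl by blast
    next
      case False
      with y have "y \<notin> fv \<alpha>" by auto
      with a obtain v where v: "\<forall>d. eval_entry a d \<longleftrightarrow> d = Abs [] [] v" "ground B (fm_subst \<sigma> \<alpha>) v"
        unfolding subst1_vacuous[OF False] by (elim first_level_unbound) auto
      have "ground B (fm_subst \<sigma> (All x \<alpha>)) (AllI (Abs [] [] v))"
        unfolding ground_All[OF \<sigma>']
        using False closed_entry_ground[OF v(2)] yields_App_ground[OF v(2)] by simp
      then show ?thesis using that v(1) closed_entry_ground[OF v(2)] by blast
    qed
    show "yields (Op ?E 0 (map \<sigma> []) as) (ground B (fm_subst \<sigma> (All x \<alpha>)))"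
      using c yields_ground[OF g]
      by (intro yields_Op[OF _ list.set_intros(1), where vs = "[c]"
          and \<sigma> = "\<lambda>_. Fn 0 []" and \<theta> = "\<lambda>_. AllI c" and \<phi> = "\<lambda>_. c"
          and e = "AllI c"]) (auto simp: as)
  qed simp
qed

lemma valid_AllE:
  assumes "inference_on L ([([], [], All x \<alpha>)], subst1 \<alpha> x t)" and free: "free_for t x \<alpha>"
  shows "logically_valid L ([([], [], All x \<alpha>)], subst1 \<alpha> x t)"
proof (cases "x \<in> fv \<alpha>")
  case True
  obtain xs where xs: "set xs = fv_tm t" using finite_list[OF finite_fv_tm] by blast
  have fvt: "fv_tm t \<subseteq> fv (subst1 \<alpha> x t)" using True by (simp add: fv_subst1[OF free])
  have "wf_fm L (subst1 \<alpha> x t)" using assms(1) by (simp add: formulas_def)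
  from wf_fm_subst_var[OF this True] have wf: "wf_tm L t" by simp
  \<comment> \<open>The operation receives the values of the variables of \<open>t\<close> as
    arguments; matching them with \<open>map Var xs\<close> lets the right-hand side evaluate
    \<open>t\<close>.\<close>
  let ?E = "[Equation 0 (map Var xs) [Abs [] [] (AllI (OVar 0))] (App (OVar 0) [t] [])]"
  show ?thesis
  proof (rule logically_validI[OF assms(1), where E = ?E and F = 0 and xs = xs])
    fix B \<sigma> as
    assume L: "expansion L (language B)"
      and \<sigma>: "\<And>z. z \<in> fv_type ([([], [], All x \<alpha>)], subst1 \<alpha> x t) \<Longrightarrow> \<sigma> z \<in> individuals B"
      and "list_all2 (first_level B \<sigma>) [([], [], All x \<alpha>)] as"
    then obtain a where as: "as = [a]" and a: "first_level B \<sigma> ([], [], All x \<alpha>) a"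
      by (auto simp: list_all2_Cons1)
    have \<sigma>': "\<forall>z \<in> fv (All x \<alpha>). \<sigma> z \<in> individuals B"
      using \<sigma> by simp
    have \<sigma>t: "\<sigma> z \<in> individuals B" if "z \<in> fv_tm t" for z
      using \<sigma> fvt that by auto
    have t: "tm_subst \<sigma> t \<in> individuals B"
      by (intro instance_individual[OF L wf] \<sigma>t)
    from a obtain u where u: "\<forall>c. eval_entry a c \<longleftrightarrow> c = Abs [] [] u" "ground B (fm_subst \<sigma> (All x \<alpha>)) u"
      by (rule first_level_unbound) auto
    from u(2) t True obtain c where c: "u = AllI c" "closed_entry c"
      "yields (App c [tm_subst \<sigma> t] []) (ground B (fm_subst (\<sigma>(x := tm_subst \<sigma> t)) \<alpha>))"
      unfolding ground_All[OF \<sigma>'] by (auto simp del: fun_upd_apply)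
    \<comment> \<open>Matching fixes every instance of the equation on the variables of
      \<open>t\<close>, hence the value of \<open>t\<close>. Outside \<open>xs\<close> a closed
      dummy is used, as \<open>\<sigma>\<close> may have open values there.\<close>
    show "yields (Op ?E 0 (map \<sigma> xs) as) (ground B (fm_subst \<sigma> (subst1 \<alpha> x t)))"
      unfolding fm_subst_subst1[OF free] using u(1) c \<sigma>t xs
      by (intro yields_Op[OF _ list.set_intros(1), where vs = "[Abs [] [] (AllI c)]"
          and \<sigma> = "\<lambda>z. if z \<in> set xs then \<sigma> z else Fn 0 []" and \<theta> = "\<lambda>_. AllI c" and \<phi> = "\<lambda>_. c"
          and e = "App c [tm_subst \<sigma> t] []"])
        (simp_all add: as individuals_def del: fun_upd_apply, rule tm_subst_cong, simp)
  qed (use xs fvt in auto)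
next
  case False
  \<comment> \<open>Now \<open>subst1 \<alpha> x t\<close> is \<open>\<alpha>\<close>, so variables
    of \<open>t\<close> may be missing from the type and are then forbidden as arguments; the stored
    operation takes no individual either.\<close>
  let ?E = "[Equation 0 [] [Abs [] [] (AllI (OVar 0))] (App (OVar 0) [] [])]"
  show ?thesis
  proof (rule logically_validI[OF assms(1), where E = ?E and F = 0 and xs = "[]"])
    fix B \<sigma> as
    assume \<sigma>: "\<And>z. z \<in> fv_type ([([], [], All x \<alpha>)], subst1 \<alpha> x t) \<Longrightarrow> \<sigma> z \<in> individuals B"
      and "list_all2 (first_level B \<sigma>) [([], [], All x \<alpha>)] as"
    then obtain a where as: "as = [a]" and a: "first_level B \<sigma> ([], [], All x \<alpha>) a"
      by (auto simp: list_all2_Cons1)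
    have \<sigma>': "\<forall>z \<in> fv (All x \<alpha>). \<sigma> z \<in> individuals B"
      using \<sigma> by simp
    from a obtain u where u: "\<forall>c. eval_entry a c \<longleftrightarrow> c = Abs [] [] u" "ground B (fm_subst \<sigma> (All x \<alpha>)) u"
      by (rule first_level_unbound) auto
    from u(2) False obtain c where c: "u = AllI c" "closed_entry c"
      "yields (App c [] []) (ground B (fm_subst \<sigma> \<alpha>))"
      unfolding ground_All[OF \<sigma>'] by auto
    show "yields (Op ?E 0 (map \<sigma> []) as) (ground B (fm_subst \<sigma> (subst1 \<alpha> x t)))"
      unfolding subst1_vacuous[OF False] using u(1) c
      by (intro yields_Op[OF _ list.set_intros(1), where vs = "[Abs [] [] (AllI c)]"
          and \<sigma> = "\<lambda>_. Fn 0 []" and \<theta> = "\<lambda>_. AllI c" and \<phi> = "\<lambda>_. c"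
          and e = "App c [] []"]) (auto simp: as)
  qed simp
qed

lemma valid_ExI:
  assumes "inference_on L ([([], [], subst1 \<alpha> x t)], Ex x \<alpha>)" and free: "free_for t x \<alpha>"
  shows "logically_valid L ([([], [], subst1 \<alpha> x t)], Ex x \<alpha>)"
proof (cases "x \<in> fv \<alpha>")
  case True
  obtain xs where xs: "set xs = fv_tm t" using finite_list[OF finite_fv_tm] by blast
  have fvt: "fv_tm t \<subseteq> fv (subst1 \<alpha> x t)" using True by (simp add: fv_subst1[OF free])
  have "wf_fm L (subst1 \<alpha> x t)" using assms(1) by (simp add: formulas_def)
  from wf_fm_subst_var[OF this True] have wf: "wf_tm L t" by simp
  let ?E = "[Equation 0 (map Var xs) [Abs [] [] (GVar 0)] (ExI (Some t) (GVar 0))]"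
  show ?thesis
  proof (rule logically_validI[OF assms(1), where E = ?E and F = 0 and xs = xs])
    fix B \<sigma> as
    assume L: "expansion L (language B)"
      and \<sigma>: "\<And>z. z \<in> fv_type ([([], [], subst1 \<alpha> x t)], Ex x \<alpha>) \<Longrightarrow> \<sigma> z \<in> individuals B"
      and "list_all2 (first_level B \<sigma>) [([], [], subst1 \<alpha> x t)] as"
    then obtain a where as: "as = [a]" and a: "first_level B \<sigma> ([], [], subst1 \<alpha> x t) a"
      by (auto simp: list_all2_Cons1)
    have \<sigma>': "\<forall>z \<in> fv (Ex x \<alpha>). \<sigma> z \<in> individuals B"
      using \<sigma> by simp
    have \<sigma>t: "\<sigma> z \<in> individuals B" if "z \<in> fv_tm t" for z
      using \<sigma> fvt that by auto
    have t: "tm_subst \<sigma> t \<in> individuals B"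
      by (intro instance_individual[OF L wf] \<sigma>t)
    from a obtain v where v: "\<forall>c. eval_entry a c \<longleftrightarrow> c = Abs [] [] v" "ground B (fm_subst \<sigma> (subst1 \<alpha> x t)) v"
      by (rule first_level_unbound) auto
    \<comment> \<open>The recorded witness is the value of \<open>t\<close> under
      \<open>\<sigma>\<close>, an individual also of the expanded language.\<close>
    from v(2) t True have g: "ground B (fm_subst \<sigma> (Ex x \<alpha>)) (ExI (Some (tm_subst \<sigma> t)) v)"
      unfolding ground_Ex[OF \<sigma>'] fm_subst_subst1[OF free] by (simp del: fun_upd_apply)
    show "yields (Op ?E 0 (map \<sigma> xs) as) (ground B (fm_subst \<sigma> (Ex x \<alpha>)))"
      using v(1) ground_closed[OF v(2)] \<sigma>t xs yields_ground[OF g]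
      by (intro yields_Op[OF _ list.set_intros(1), where vs = "[Abs [] [] v]"
          and \<sigma> = "\<lambda>z. if z \<in> set xs then \<sigma> z else Fn 0 []" and \<theta> = "\<lambda>_. v"
          and \<phi> = "\<lambda>_. Abs [] [] v" and e = "ExI (Some (tm_subst \<sigma> t)) v"])
        (auto simp: as individuals_def simp del: fun_upd_apply intro!: tm_subst_cong)
  qed (use xs fvt in auto)
next
  case False
  \<comment> \<open>The premise is \<open>\<alpha>\<close> itself: no witness is recorded and no
    individual argument is taken.\<close>
  let ?E = "[Equation 0 [] [Abs [] [] (GVar 0)] (ExI None (GVar 0))]"
  show ?thesis
  proof (rule logically_validI[OF assms(1), where E = ?E and F = 0 and xs = "[]"])
    fix B \<sigma> as
    assume \<sigma>: "\<And>z. z \<in> fv_type ([([], [], subst1 \<alpha> x t)], Ex x \<alpha>) \<Longrightarrow> \<sigma> z \<in> individuals B"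
      and "list_all2 (first_level B \<sigma>) [([], [], subst1 \<alpha> x t)] as"
    then obtain a where as: "as = [a]" and a: "first_level B \<sigma> ([], [], subst1 \<alpha> x t) a"
      by (auto simp: list_all2_Cons1)
    have \<sigma>': "\<forall>z \<in> fv (Ex x \<alpha>). \<sigma> z \<in> individuals B"
      using \<sigma> by simp
    from a obtain v where v: "\<forall>c. eval_entry a c \<longleftrightarrow> c = Abs [] [] v" "ground B (fm_subst \<sigma> \<alpha>) v"
      unfolding subst1_vacuous[OF False] by (rule first_level_unbound) auto
    from v(2) False have g: "ground B (fm_subst \<sigma> (Ex x \<alpha>)) (ExI None v)"
      unfolding ground_Ex[OF \<sigma>'] by simp
    show "yields (Op ?E 0 (map \<sigma> []) as) (ground B (fm_subst \<sigma> (Ex x \<alpha>)))"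
      using v(1) ground_closed[OF v(2)] yields_ground[OF g]
      by (intro yields_Op[OF _ list.set_intros(1), where vs = "[Abs [] [] v]"
          and \<sigma> = "\<lambda>_. Fn 0 []" and \<theta> = "\<lambda>_. v" and \<phi> = "\<lambda>_. Abs [] [] v"
          and e = "ExI None v"]) (auto simp: as)
  qed simp
qed

lemma valid_ExE:
  assumes "inference_on L ([([], [], Ex x \<alpha>), ([y], [subst1 \<alpha> x (Var y)], \<gamma>)], \<gamma>)"
    and free: "free_for (Var y) x \<alpha>" and y: "y \<notin> fv (Ex x \<alpha>)" and y\<gamma>: "y \<notin> fv \<gamma>"
  shows "logically_valid L ([([], [], Ex x \<alpha>), ([y], [subst1 \<alpha> x (Var y)], \<gamma>)], \<gamma>)"
proof (cases "x \<in> fv \<alpha>")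
  case True
  \<comment> \<open>The individual variable \<open>Var 0\<close> in the pattern reads the witness
    off the canonical ground, to be handed to the minor premise in place of the
    eigenvariable.\<close>
  let ?E = "[Equation 0 [] [Abs [] [] (ExI (Some (Var 0)) (GVar 0)), OVar 0]
    (App (OVar 0) [Var 0] [GVar 0])]"
  show ?thesis
  proof (rule logically_validI[OF assms(1), where E = ?E and F = 0 and xs = "[]"])
    fix B \<sigma> as
    assume \<sigma>: "\<And>z. z \<in> fv_type ([([], [], Ex x \<alpha>), ([y], [subst1 \<alpha> x (Var y)], \<gamma>)], \<gamma>)
        \<Longrightarrow> \<sigma> z \<in> individuals B"
      and "list_all2 (first_level B \<sigma>) [([], [], Ex x \<alpha>), ([y], [subst1 \<alpha> x (Var y)], \<gamma>)] as"
    then obtain a b where as: "as = [a, b]" and a: "first_level B \<sigma> ([], [], Ex x \<alpha>) a"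
      and b: "first_level B \<sigma> ([y], [subst1 \<alpha> x (Var y)], \<gamma>) b"
      by (auto simp: list_all2_Cons1)
    have \<sigma>': "\<forall>z \<in> fv (Ex x \<alpha>). \<sigma> z \<in> individuals B"
      using \<sigma> by simp
    from a obtain u where u: "\<forall>c. eval_entry a c \<longleftrightarrow> c = Abs [] [] u" "ground B (fm_subst \<sigma> (Ex x \<alpha>)) u"
      by (rule first_level_unbound) auto
    from u(2) True obtain t h where h: "u = ExI (Some t) h" "t \<in> individuals B"
      "ground B (fm_subst (\<sigma>(x := t)) \<alpha>) h"
      unfolding ground_Ex[OF \<sigma>'] by (auto simp del: fun_upd_apply)
    \<comment> \<open>The stored ground is one for \<open>\<alpha>\<close> at the witness. This is
      the discharged assumption with \<open>y\<close> instantiated by the witness, while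
      \<open>\<gamma>\<close> does not depend on \<open>y\<close>.\<close>
    have eigen: "fm_subst (\<sigma>(y := t)) (subst1 \<alpha> x (Var y)) = fm_subst (\<sigma>(x := t)) \<alpha>"
      using y by (intro fm_subst_eigenvariable[OF free]) simp
    have \<gamma>: "fm_subst (\<sigma>(y := t)) \<gamma> = fm_subst \<sigma> \<gamma>"
      using y\<gamma> by (intro fm_subst_cong) auto
    have "y \<in> fv (subst1 \<alpha> x (Var y))" using True by (simp add: fv_subst1[OF free])
    then have "filter (\<lambda>z. z \<in> (\<Union>\<delta> \<in> set [subst1 \<alpha> x (Var y)]. fv \<delta>) \<union> fv \<gamma>) [y] = [y]" by simp
    with b have app: "yields (App b [t] [h]) (ground B (fm_subst \<sigma> \<gamma>))"
    proof (rule first_level_AbsE)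
      assume "\<And>ts hs. \<lbrakk>length ts = length [y]; set ts \<subseteq> individuals B;
          list_all2 (\<lambda>\<delta>. ground B (fm_subst (upd \<sigma> [y] ts) \<delta>)) [subst1 \<alpha> x (Var y)] hs\<rbrakk>
        \<Longrightarrow> yields (App b ts hs) (ground B (fm_subst (upd \<sigma> [y] ts) \<gamma>))"
      from this[of "[t]" "[h]"] show ?thesis
        using h eigen \<gamma> by (simp del: fun_upd_apply)
    qed
    have vals: "\<forall>d. eval_entry b d \<longleftrightarrow> d = b" "closed_entry b"
      using first_level_bound[OF b] by auto
    show "yields (Op ?E 0 (map \<sigma> []) as) (ground B (fm_subst \<sigma> \<gamma>))"
      using u(1) h(1,2) vals ground_closed[OF h(3)] app
      by (intro yields_Op[OF _ list.set_intros(1), where vs = "[Abs [] [] (ExI (Some t) h), b]"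
          and \<sigma> = "\<lambda>_. t" and \<theta> = "\<lambda>_. h" and \<phi> = "\<lambda>_. b"
          and e = "App b [t] [h]"]) (auto simp: as individuals_def)
  qed simp
next
  case False
  let ?E = "[Equation 0 [] [Abs [] [] (ExI None (GVar 0)), OVar 0] (App (OVar 0) [] [GVar 0])]"
  show ?thesis
  proof (rule logically_validI[OF assms(1), where E = ?E and F = 0 and xs = "[]"])
    fix B \<sigma> as
    assume \<sigma>: "\<And>z. z \<in> fv_type ([([], [], Ex x \<alpha>), ([y], [subst1 \<alpha> x (Var y)], \<gamma>)], \<gamma>)
        \<Longrightarrow> \<sigma> z \<in> individuals B"
      and "list_all2 (first_level B \<sigma>) [([], [], Ex x \<alpha>), ([y], [subst1 \<alpha> x (Var y)], \<gamma>)] as"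
    then obtain a b where as: "as = [a, b]" and a: "first_level B \<sigma> ([], [], Ex x \<alpha>) a"
      and b: "first_level B \<sigma> ([y], [\<alpha>], \<gamma>) b"
      by (auto simp: list_all2_Cons1 subst1_vacuous[OF False])
    have \<sigma>': "\<forall>z \<in> fv (Ex x \<alpha>). \<sigma> z \<in> individuals B"
      using \<sigma> by simp
    from a obtain u where u: "\<forall>c. eval_entry a c \<longleftrightarrow> c = Abs [] [] u" "ground B (fm_subst \<sigma> (Ex x \<alpha>)) u"
      by (rule first_level_unbound) auto
    from u(2) False obtain h where h: "u = ExI None h" "ground B (fm_subst \<sigma> \<alpha>) h"
      unfolding ground_Ex[OF \<sigma>'] by auto
    \<comment> \<open>With \<open>x\<close> not free the discharged assumption is
      \<open>\<alpha>\<close>, and \<open>y\<close> is free neither there nor in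
      \<open>\<gamma>\<close>: the minor premise takes a ground but no individual.\<close>
    have "filter (\<lambda>z. z \<in> (\<Union>\<delta> \<in> set [\<alpha>]. fv \<delta>) \<union> fv \<gamma>) [y] = []" using y y\<gamma> False by auto
    with b have app: "yields (App b [] [h]) (ground B (fm_subst \<sigma> \<gamma>))"
      by (rule first_level_AbsE) (use h in auto)
    have vals: "\<forall>d. eval_entry b d \<longleftrightarrow> d = b" "closed_entry b"
      using first_level_bound[OF b] by auto
    show "yields (Op ?E 0 (map \<sigma> []) as) (ground B (fm_subst \<sigma> \<gamma>))"
      using u(1) h(1) vals ground_closed[OF h(2)] app
      by (intro yields_Op[OF _ list.set_intros(1), where vs = "[Abs [] [] (ExI None h), b]"
          and \<sigma> = "\<lambda>_. Fn 0 []" and \<theta> = "\<lambda>_. h" and \<phi> = "\<lambda>_. b"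
          and e = "App b [] [h]"]) (auto simp: as)
  qed simp
qed

section \<open>From rules to derivations\<close>

lemma IL_rule_logically_valid:
  assumes "IL_rule i" "inference_on L i"
  shows "logically_valid L i"
  using assms
  by cases (blast intro: valid_AndI valid_AndE1 valid_AndE2 valid_OrI1 valid_OrI2 valid_OrE valid_ImpI
      valid_ImpE valid_AllI valid_AllE valid_ExI valid_ExE valid_BotE)+

lemma chain_mono:
  assumes "chain L R \<Delta> \<alpha>" "\<And>i. R i \<Longrightarrow> R' i"
  shows "chain L R' \<Delta> \<alpha>"
  using assms(1)
proof induction
  case (assumption \<alpha>)
  then show ?case by (rule chain.assumption)
next
  case (inference ps \<beta> \<Delta>s)
  then show ?case by (intro chain.inference) (auto simp: assms(2) split: prod.splits)
qed

theorem theorem29: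
  fixes L :: lang and \<Gamma> :: "fm set" and \<alpha> :: fm
  assumes "\<Gamma> \<subseteq> formulas L"
    and "\<alpha> \<in> formulas L"
    and "IL_derivable L \<Gamma> \<alpha>"
  shows "logical_consequence L \<Gamma> \<alpha>"
proof -
  from assms(3) obtain \<Delta> where "\<Delta> \<subseteq> \<Gamma>" "chain L (\<lambda>i. inference_on L i \<and> IL_rule i) \<Delta> \<alpha>"
    unfolding IL_derivable_def by blast
  moreover from this(2) have "chain L (logically_valid L) \<Delta> \<alpha>"
    by (rule chain_mono) (blast intro: IL_rule_logically_valid)
  ultimately show ?thesis
    unfolding logical_consequence_def by blast
qed

end
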